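(* Let $P=\{p_r\}_{r=1}^k$ be a finite set of primes. Suppose that $f$ is an element of $\mathrm{FG}_n(P)$. Then $$Q+R\,\llbracket f\rrbracket_{n,a}\le |f|_{n,P}\le S+T\,\llbracket f\rrbracket_{n,a}$$ for some positive, real constants $Q,R,S$ and $T$, where $\llbracket f\rrbracket_{n,a}$ is the adelic length of $f$ and $|f|_{n,P}$ is the word length of $f$ with respect to the generating set $K_P$.
   Context: Let $n$ be a natural number and $P$ a non-empty, finite set of primes. For $1\le r\le s\le n$ and $q\in\mathbb{Q}$, $\theta_{rs}(q)$ is the $n\times n$ matrix equal to $q$ at entry $(r,s)$ and equal to the identity matrix at every other entry. $U=\{\theta_{rs}(1),\theta_{rs}(1)^{-1}:1\le r<s\le n\}$, $J_P=\{\theta_{rr}(p),\theta_{rr}(p)^{-1}:p\in P,\ 1\le r\le n\}$, $K_P=U\cup J_P$, and $\mathrm{FG}_n(P)$ is the subgroup of $GL_n(\mathbb{Q})$ generated by $K_P$. The word length $|f|_{n,P}$ of $f\in\mathrm{FG}_n(P)$ is the smallest number of elements of $K_P$ whose product is $f$. For a prime $p$ and $v=(v_1,\dots,v_n)\in\mathbb{Q}_p^n$ let $|v|_p=\max_{1\le i\le n}|v_i|_p$; for $v\in\mathbb{R}^n$ let $|v|_\infty=\sqrt{\sum_{i=1}^n|v_i|^2}$. For $f\in GL_n(\mathbb{Q})$ and $p$ a prime or $p=\infty$, $\|f\|_p=\sup_{|v|_p=1}|fv|_p$ (with $v\in\mathbb{Q}_p^n$, respectively $v\in\mathbb{R}^n$).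 With $\mathcal{P}$ the set of all primes together with $\infty$, and $\ln^+$ the positive part of the natural logarithm, the adelic length of $f\in GL_n(\mathbb{Q})$ is $$\llbracket f\rrbracket_{n,a}=\sum_{p\in\mathcal{P}}\left(\ln^+\|f\|_p+\ln^+\|f^{-1}\|_p\right).$$
   Formalization: The lower bound is stated only for f different from the identity matrix: the identity has word length 0 (empty product) and adelic length 0, so a positive Q is impossible there. The upper bound covers all f. *)

theory Defs
  imports
    "HOL-Analysis.Analysis"
    "HOL-Algebra.Generated_Groups"
    "HOL-Algebra.QuotRing"
begin

text \<open>
  Matrices of size \<open>n\<close> over the rationals have type \<open>rat^'n^'n\<close>, where the index type \<open>'n\<close> is finite
  and linearly ordered; its \<open>n = CARD('n) \<ge> 1\<close> elements play the role of the indices \<open>1 < \<dots> < n\<close>.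
\<close>

section \<open>The groups \<open>FG\<^sub>n(P)\<close> and their word length\<close>

definition GL :: "(rat^'n^'n) monoid" where
  "GL = \<lparr>carrier = {A. invertible A}, mult = (**), one = mat 1\<rparr>"

definition theta :: "'n::finite \<Rightarrow> 'n \<Rightarrow> rat \<Rightarrow> rat^'n^'n" where
  "theta r s q = (\<chi> i j. if i = r \<and> j = s then q else mat 1 $ i $ j)"

definition gens_U :: "(rat^'n::{finite,linorder}^'n::{finite,linorder}) set" where
  "gens_U = (\<Union>(r, s)\<in>{(r, s). r < s}. {theta r s 1, matrix_inv (theta r s 1)})"

definition gens_J :: "nat set \<Rightarrow> (rat^'n::{finite,linorder}^'n::{finite,linorder}) set" where
  "gens_J P = (\<Union>p\<in>P. \<Union>r. {theta r r (of_nat p), matrix_inv (theta r r (of_nat p))})"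

definition gens_K :: "nat set \<Rightarrow> (rat^'n::{finite,linorder}^'n::{finite,linorder}) set" where
  "gens_K P = gens_U \<union> gens_J P"

definition FG :: "nat set \<Rightarrow> (rat^'n::{finite,linorder}^'n::{finite,linorder}) set" where
  "FG P = generate GL (gens_K P)"

text \<open>The empty product is allowed, so the identity matrix has word length \<open>0\<close>.\<close>

definition word_length :: "nat set \<Rightarrow> rat^'n::{finite,linorder}^'n::{finite,linorder} \<Rightarrow> nat" where
  "word_length P f =
     (LEAST k. \<exists>ws. length ws = k \<and> set ws \<subseteq> gens_K P \<and> foldr (**) ws (mat 1) = f)"


section \<open>The field of \<open>p\<close>-adic numbers\<close>

text \<open>
  \<open>\<rat>\<^sub>p\<close> is the completion of the rationals: the ring of \<open>p\<close>-adic Cauchy sequences modulo the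
  ideal of \<open>p\<close>-adic null sequences. It is a term-level ring because \<open>p\<close> ranges over all primes.
\<close>

definition rat_absp :: "nat \<Rightarrow> rat \<Rightarrow> real" where
  "rat_absp p q =
     (if q = 0 then 0
      else real p powi (int (multiplicity (int p) (snd (quotient_of q)))
                        - int (multiplicity (int p) (fst (quotient_of q)))))"

definition padic_cauchy :: "nat \<Rightarrow> (nat \<Rightarrow> rat) ring" where
  "padic_cauchy p =
     \<lparr>carrier = {x. \<forall>e>0. \<exists>N. \<forall>m\<ge>N. \<forall>n\<ge>N. rat_absp p (x m - x n) < e},
      mult = (\<lambda>x y k. x k * y k), one = (\<lambda>k. 1),
      zero = (\<lambda>k. 0), add = (\<lambda>x y k. x k + y k)\<rparr>"

definition padic_null :: "nat \<Rightarrow> (nat \<Rightarrow> rat) set" where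
  "padic_null p = {x. (\<lambda>k. rat_absp p (x k)) \<longlonglongrightarrow> 0}"

definition Qp :: "nat \<Rightarrow> (nat \<Rightarrow> rat) set ring" where
  "Qp p = padic_cauchy p Quot padic_null p"

definition Qp_of_rat :: "nat \<Rightarrow> rat \<Rightarrow> (nat \<Rightarrow> rat) set" where
  "Qp_of_rat p q = padic_null p +>\<^bsub>padic_cauchy p\<^esub> (\<lambda>k. q)"

definition Qp_abs :: "nat \<Rightarrow> (nat \<Rightarrow> rat) set \<Rightarrow> real" where
  "Qp_abs p a = (THE r. \<forall>x\<in>a. (\<lambda>k. rat_absp p (x k)) \<longlonglongrightarrow> r)"


section \<open>Operator norms and adelic length\<close>

text \<open>Vectors over \<open>\<rat>\<^sub>p\<close> are functions from the index type into \<open>carrier (Qp p)\<close>.\<close>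

definition Qp_vec_abs :: "nat \<Rightarrow> ('n::finite \<Rightarrow> (nat \<Rightarrow> rat) set) \<Rightarrow> real" where
  "Qp_vec_abs p v = Max (range (\<lambda>i. Qp_abs p (v i)))"

definition Qp_mult_vec ::
    "nat \<Rightarrow> rat^'n::finite^'n::finite \<Rightarrow> ('n \<Rightarrow> (nat \<Rightarrow> rat) set) \<Rightarrow> 'n \<Rightarrow> (nat \<Rightarrow> rat) set" where
  "Qp_mult_vec p f v =
     (\<lambda>i. \<Oplus>\<^bsub>Qp p\<^esub>j\<in>UNIV. Qp_of_rat p (f $ i $ j) \<otimes>\<^bsub>Qp p\<^esub> v j)"

text \<open>The places of the rationals: the primes together with \<open>\<infinity>\<close>.\<close>

datatype place = Finite nat | Infinite

definition places :: "place set" where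
  "places = insert Infinite (Finite ` {p. prime p})"

fun op_norm :: "place \<Rightarrow> rat^'n::finite^'n::finite \<Rightarrow> real" where
  "op_norm (Finite p) f =
     (SUP v\<in>{v \<in> UNIV \<rightarrow> carrier (Qp p). Qp_vec_abs p v = 1}. Qp_vec_abs p (Qp_mult_vec p f v))"
| "op_norm Infinite f =
     (SUP v\<in>{v :: real^'n. norm v = 1}. norm (map_matrix of_rat f *v v))"

definition ln_plus :: "real \<Rightarrow> real" where
  "ln_plus x = max 0 (ln x)"

text \<open>For invertible \<open>f\<close> only finitely many places contribute, so the sum is summable.\<close>

definition adelic_length :: "rat^'n::finite^'n::finite \<Rightarrow> real" where
  "adelic_length f =
     (\<Sum>\<^sub>\<infinity>p\<in>places. ln_plus (op_norm p f) + ln_plus (op_norm p (matrix_inv f)))"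

end

theory Submission
  imports Defs
begin

text \<open>
  An element of \<open>FG P\<close> is upper triangular with positive diagonal, and its entries and inverse
  diagonal entries are integral at every prime outside \<open>P\<close>; hence only the places in
  \<open>P \<union> {\<infinity>}\<close> contribute to the adelic length, and up to constants the operator norms are the
  maxima of the absolute values of the entries.

  Entries of a product of \<open>k\<close> generators grow at most exponentially in \<open>k\<close>, which gives the lower
  bound.  For the upper bound, numerators and denominators of the entries of \<open>f\<close> are at most
  \<open>exp h\<close>, where \<open>h\<close> is the adelic length.  Factor \<open>f\<close> into a diagonal matrix and
  elementary matrices \<open>theta r s (a / b)\<close>.  Since \<open>theta r r p\<close> conjugates \<open>theta r s x\<close> to
  \<open>theta r s (p * x)\<close>, Horner's scheme in base \<open>p \<in> P\<close> writes \<open>theta r s a\<close> with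
  \<open>O(1 + ln a)\<close> letters, and the denominator costs another conjugation.
\<close>

section \<open>The \<open>p\<close>-adic absolute value on the rationals\<close>

lemma rat_absp_0 [simp]: "rat_absp p 0 = 0"
  by (simp add: rat_absp_def)

lemma rat_absp_nonneg [simp]: "0 \<le> rat_absp p x"
  by (simp add: rat_absp_def)

text \<open>Multiplicities are additive, and two fractions for the same number satisfy
  \<open>a * d = c * b\<close>, so the difference of multiplicities does not depend on the
  representation. This frees later arguments from lowest terms.\<close>

lemma rat_absp_divide_of_int:
  assumes p: "prime p" and a: "a \<noteq> 0" and b: "b \<noteq> 0"
  shows "rat_absp p (of_int a / of_int b)
    = real p powi (int (multiplicity (int p) b) - int (multiplicity (int p) a))"
proof -
  define x :: rat where "x = of_int a / of_int b"
  obtain c d where cd: "quotient_of x = (c, d)" by force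
  have x0: "x \<noteq> 0" using a b by (simp add: x_def)
  have d: "d > 0" using quotient_of_denom_pos[OF cd] .
  have xcd: "x = of_int c / of_int d" using quotient_of_div[OF cd] .
  have c: "c \<noteq> 0" using x0 xcd by auto
  have "(of_int (a * d) :: rat) = of_int (c * b)"
    using xcd b d by (simp add: x_def field_simps)
  then have eq: "a * d = c * b" by linarith
  have pe: "prime_elem (int p)" using p by auto
  have "multiplicity (int p) (a * d) = multiplicity (int p) a + multiplicity (int p) d"
    using prime_elem_multiplicity_mult_distrib[OF pe] a d by auto
  moreover have "multiplicity (int p) (c * b) = multiplicity (int p) c + multiplicity (int p) b"
    using prime_elem_multiplicity_mult_distrib[OF pe] c b by auto
  ultimately have "int (multiplicity (int p) b) - int (multiplicity (int p) a)
      = int (multiplicity (int p) d) - int (multiplicity (int p) c)"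
    using eq by simp
  then show ?thesis
    using x0 cd unfolding x_def[symmetric] by (simp add: rat_absp_def)
qed

text \<open>Over a shared denominator, products and sums are read off from the numerators, where
  multiplicities can be compared directly.\<close>

lemma rat_common_denominator:
  obtains a b c :: int where "b \<noteq> 0" "x = of_int a / (of_int b :: rat)" "y = (of_int c / of_int b :: rat)"
proof -
  obtain a1 b1 where 1: "quotient_of x = (a1, b1)" by force
  obtain a2 b2 where 2: "quotient_of y = (a2, b2)" by force
  have "b1 > 0" "b2 > 0" using 1 2 quotient_of_denom_pos by auto
  then show ?thesis
    using that[of "b1 * b2" "a1 * b2" "a2 * b1"] quotient_of_div[OF 1] quotient_of_div[OF 2]
    by simp
qed

lemma rat_absp_mult:
  assumes p: "prime p"
  shows "rat_absp p (x * y) = rat_absp p x * rat_absp p y"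
proof (cases "x = 0 \<or> y = 0")
  case False
  obtain a b c where abc: "b \<noteq> 0" "x = of_int a / of_int b" "y = of_int c / of_int b"
    by (rule rat_common_denominator)
  have ac: "a \<noteq> 0" "c \<noteq> 0" using False abc by auto
  have pe: "prime_elem (int p)" using p by auto
  have xy: "x * y = of_int (a * c) / of_int (b * b)" using abc by simp
  have "p \<noteq> 0" using p by auto
  show ?thesis
    unfolding xy using abc ac \<open>p \<noteq> 0\<close>
    by (simp only: rat_absp_divide_of_int[OF p] mult_eq_0_iff simp_thms abc
        prime_elem_multiplicity_mult_distrib[OF pe])
      (simp flip: power_int_add add: algebra_simps)
qed auto

lemma rat_absp_1 [simp]: "prime p \<Longrightarrow> rat_absp p 1 = 1"
  using rat_absp_divide_of_int[of p 1 1] by simp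

lemma rat_absp_minus [simp]:
  assumes p: "prime p"
  shows "rat_absp p (- x) = rat_absp p x"
proof -
  have "rat_absp p (- 1) = 1"
    using rat_absp_divide_of_int[OF p, of "-1" 1] by (simp add: multiplicity_unit_right)
  then show ?thesis
    using rat_absp_mult[OF p, of "-1" x] by simp
qed

lemma rat_absp_diff_commute: "prime p \<Longrightarrow> rat_absp p (x - y) = rat_absp p (y - x)"
  using rat_absp_minus[of p "x - y"] by simp

lemma rat_absp_inverse:
  assumes p: "prime p"
  shows "rat_absp p (inverse x) = inverse (rat_absp p x)"
proof (cases "x = 0")
  case False
  then have "rat_absp p x * rat_absp p (inverse x) = 1"
    using rat_absp_mult[OF p, of x "inverse x"] p by simp
  then show ?thesis by (simp add: inverse_unique)
qed auto

lemma rat_absp_add_le: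
  assumes p: "prime p"
  shows "rat_absp p (x + y) \<le> max (rat_absp p x) (rat_absp p y)"
proof (cases "x = 0 \<or> y = 0 \<or> x + y = 0")
  case True
  then show ?thesis by (auto simp: max_def)
next
  case False
  obtain a b c where abc: "b \<noteq> 0" "x = of_int a / of_int b" "y = of_int c / of_int b"
    by (rule rat_common_denominator)
  have xy: "x + y = of_int (a + c) / of_int b" using abc by (simp add: add_divide_distrib)
  have nz: "a \<noteq> 0" "c \<noteq> 0" "a + c \<noteq> 0" using False abc xy by auto
  let ?m = "multiplicity (int p)"
  \<comment> \<open>The strong triangle inequality amounts to this divisibility: the smaller power
    of \<open>p\<close> divides both numerators, hence their sum.\<close>
  have "int p ^ min (?m a) (?m c) dvd a + c"
    by (intro dvd_add multiplicity_dvd') auto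
  then have "min (?m a) (?m c) \<le> ?m (a + c)"
    using nz p by (intro multiplicity_geI) auto
  then consider "?m a \<le> ?m (a + c)" | "?m c \<le> ?m (a + c)" by linarith
  moreover have "real p \<ge> 1" using prime_ge_1_nat[OF p] by simp
  moreover have "rat_absp p x = real p powi (int (?m b) - int (?m a))"
    unfolding abc(2) by (rule rat_absp_divide_of_int[OF p nz(1) abc(1)])
  moreover have "rat_absp p y = real p powi (int (?m b) - int (?m c))"
    unfolding abc(3) by (rule rat_absp_divide_of_int[OF p nz(2) abc(1)])
  moreover have "rat_absp p (x + y) = real p powi (int (?m b) - int (?m (a + c)))"
    unfolding xy by (rule rat_absp_divide_of_int[OF p nz(3) abc(1)])
  ultimately show ?thesis
    by cases (auto simp: le_max_iff_disj intro!: power_int_increasing)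
qed

lemma rat_absp_add_le_add:
  "prime p \<Longrightarrow> rat_absp p (x + y) \<le> rat_absp p x + rat_absp p y"
  using rat_absp_add_le[of p x y] rat_absp_nonneg[of p x] rat_absp_nonneg[of p y] by linarith

lemma rat_absp_triangle3:
  assumes "prime p"
  shows "\<bar>rat_absp p x - rat_absp p y\<bar> \<le> rat_absp p (x - y)"
  using rat_absp_add_le_add[OF assms, of "x - y" y] rat_absp_add_le_add[OF assms, of "y - x" x]
    rat_absp_diff_commute[OF assms, of x y] by simp

text \<open>By the strong triangle inequality the bound does not grow with the number of summands;
  \<open>0 \<le> B\<close> covers the empty sum.\<close>

lemma rat_absp_sum_le:
  assumes p: "prime p" and "finite A" and "0 \<le> B" and "\<And>i. i \<in> A \<Longrightarrow> rat_absp p (g i) \<le> B"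
  shows "rat_absp p (\<Sum>i\<in>A. g i) \<le> B"
  using assms(2,4)
proof (induction A rule: finite_induct)
  case (insert i A)
  then show ?case
    using rat_absp_add_le[OF p, of "g i" "\<Sum>i\<in>A. g i"] by force
qed (use assms in auto)

lemma rat_absp_of_nat_prime:
  assumes p: "prime p" and q: "prime q"
  shows "rat_absp p (of_nat q) = (if p = q then 1 / real p else 1)"
proof -
  have "multiplicity (int p) (int q) = (if p = q then 1 else 0)"
    using p q by (simp add: prime_multiplicity_other multiplicity_self)
  then show ?thesis
    using rat_absp_divide_of_int[OF p, of "int q" 1] prime_gt_0_nat[OF q]
    by (auto simp: power_int_minus divide_simps)
qed

text \<open>If \<open>p\<close> divides the denominator of a reduced fraction, it does not divide
  the numerator, so the absolute value is exactly this power of \<open>p\<close>. Otherwise the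
  power is 1.\<close>

lemma prime_power_denominator_le:
  assumes p: "prime p" and q: "quotient_of x = (a, b)"
  shows "real p ^ multiplicity (int p) b \<le> max 1 (rat_absp p x)"
proof (cases "multiplicity (int p) b = 0 \<or> x = 0")
  case True
  then show ?thesis using q by auto
next
  case False
  have "int p dvd b" using False not_dvd_imp_multiplicity_0 by blast
  then have "\<not> int p dvd a"
    using coprime_common_divisor[OF quotient_of_coprime[OF q]] p not_prime_unit[of "int p"]
    by (metis prime_nat_int_transfer)
  then have "multiplicity (int p) a = 0" by (rule not_dvd_imp_multiplicity_0)
  then show ?thesis using False q by (simp add: rat_absp_def)
qed

section \<open>The ring of \<open>p\<close>-adic numbers\<close>

lemma padic_cauchy_simps [simp]:
  "x \<otimes>\<^bsub>padic_cauchy p\<^esub> y = (\<lambda>k. x k * y k)"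
  "x \<oplus>\<^bsub>padic_cauchy p\<^esub> y = (\<lambda>k. x k + y k)"
  "\<one>\<^bsub>padic_cauchy p\<^esub> = (\<lambda>k. 1)"
  "\<zero>\<^bsub>padic_cauchy p\<^esub> = (\<lambda>k. 0)"
  by (simp_all add: padic_cauchy_def)

section \<open>Arithmetic of p-adic Cauchy sequences\<close>

lemma padic_cauchy_carrier_iff:
  "x \<in> carrier (padic_cauchy p)
    \<longleftrightarrow> (\<forall>e>0. \<exists>N. \<forall>m\<ge>N. \<forall>n\<ge>N. rat_absp p (x m - x n) < e)"
  by (simp add: padic_cauchy_def)

lemma padic_cauchy_const [simp]: "(\<lambda>k. c) \<in> carrier (padic_cauchy p)"
  by (simp add: padic_cauchy_carrier_iff)

text \<open>The reverse triangle inequality turns a p-adic Cauchy sequence into a real Cauchy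
  sequence of absolute values.\<close>

lemma padic_cauchy_convergent:
  assumes p: "prime p" and x: "x \<in> carrier (padic_cauchy p)"
  shows "convergent (\<lambda>k. rat_absp p (x k))"
proof -
  have "Cauchy (\<lambda>k. rat_absp p (x k))"
  proof (rule metric_CauchyI)
    fix e :: real assume "e > 0"
    then obtain N where N: "\<forall>m\<ge>N. \<forall>n\<ge>N. rat_absp p (x m - x n) < e"
      using x unfolding padic_cauchy_carrier_iff by blast
    show "\<exists>M. \<forall>m\<ge>M. \<forall>n\<ge>M. dist (rat_absp p (x m)) (rat_absp p (x n)) < e"
      using N rat_absp_triangle3[OF p] unfolding dist_real_def by (meson le_less_trans)
  qed
  then show ?thesis by (rule Cauchy_convergent)
qed

lemma padic_cauchy_bounded:
  assumes p: "prime p" and x: "x \<in> carrier (padic_cauchy p)"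
  obtains B where "B > 0" "\<And>k. rat_absp p (x k) \<le> B"
proof -
  have "Bseq (\<lambda>k. rat_absp p (x k))"
    using padic_cauchy_convergent[OF assms] by (rule convergent_imp_Bseq)
  then show ?thesis
    using that unfolding Bseq_def by auto
qed

lemma padic_cauchy_add:
  assumes p: "prime p" and x: "x \<in> carrier (padic_cauchy p)" and y: "y \<in> carrier (padic_cauchy p)"
  shows "(\<lambda>k. x k + y k) \<in> carrier (padic_cauchy p)"
  unfolding padic_cauchy_carrier_iff
proof (intro allI impI)
  fix e :: real assume e: "e > 0"
  obtain N1 where N1: "\<forall>m\<ge>N1. \<forall>n\<ge>N1. rat_absp p (x m - x n) < e"
    using x e unfolding padic_cauchy_carrier_iff by blast
  obtain N2 where N2: "\<forall>m\<ge>N2. \<forall>n\<ge>N2. rat_absp p (y m - y n) < e"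
    using y e unfolding padic_cauchy_carrier_iff by blast
  show "\<exists>N. \<forall>m\<ge>N. \<forall>n\<ge>N. rat_absp p (x m + y m - (x n + y n)) < e"
  proof (intro exI allI impI)
    fix m n assume "m \<ge> max N1 N2" "n \<ge> max N1 N2"
    then have "rat_absp p (x m - x n) < e" "rat_absp p (y m - y n) < e" using N1 N2 by auto
    then show "rat_absp p (x m + y m - (x n + y n)) < e"
      using rat_absp_add_le[OF p, of "x m - x n" "y m - y n"] by (simp add: algebra_simps)
  qed
qed

lemma padic_cauchy_mult:
  assumes p: "prime p" and x: "x \<in> carrier (padic_cauchy p)" and y: "y \<in> carrier (padic_cauchy p)"
  shows "(\<lambda>k. x k * y k) \<in> carrier (padic_cauchy p)"
  unfolding padic_cauchy_carrier_iff
proof (intro allI impI)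
  fix e :: real assume e: "e > 0"
  obtain A where A: "A > 0" "\<And>k. rat_absp p (x k) \<le> A" using padic_cauchy_bounded[OF p x] by blast
  obtain B where B: "B > 0" "\<And>k. rat_absp p (y k) \<le> B" using padic_cauchy_bounded[OF p y] by blast
  \<comment> \<open>The difference of products splits as
    \<open>x m * (y m - y n) + (x m - x n) * y n\<close>. The strong triangle inequality lets both
    parts use the full \<open>e\<close>, without halving.\<close>
  have "e / B > 0" "e / A > 0" using e A B by auto
  then obtain N1 N2
    where N1: "\<forall>m\<ge>N1. \<forall>n\<ge>N1. rat_absp p (x m - x n) < e / B"
      and N2: "\<forall>m\<ge>N2. \<forall>n\<ge>N2. rat_absp p (y m - y n) < e / A"
    using x y unfolding padic_cauchy_carrier_iff by meson
  show "\<exists>N. \<forall>m\<ge>N. \<forall>n\<ge>N. rat_absp p (x m * y m - x n * y n) < e"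
  proof (intro exI allI impI)
    fix m n assume mn: "m \<ge> max N1 N2" "n \<ge> max N1 N2"
    have "rat_absp p (x m * (y m - y n)) < e"
    proof -
      have "rat_absp p (x m) * rat_absp p (y m - y n) \<le> A * rat_absp p (y m - y n)"
        using A by (intro mult_right_mono) auto
      also have "\<dots> < A * (e / A)" using N2 mn A(1) by (intro mult_strict_left_mono) auto
      finally show ?thesis using A by (simp add: rat_absp_mult[OF p])
    qed
    moreover have "rat_absp p ((x m - x n) * y n) < e"
    proof -
      have "rat_absp p (x m - x n) * rat_absp p (y n) \<le> rat_absp p (x m - x n) * B"
        using B by (intro mult_left_mono) auto
      also have "\<dots> < (e / B) * B" using N1 mn B(1) by (intro mult_strict_right_mono) auto
      finally show ?thesis using B by (simp add: rat_absp_mult[OF p])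
    qed
    ultimately show "rat_absp p (x m * y m - x n * y n) < e"
      using rat_absp_add_le[OF p, of "x m * (y m - y n)" "(x m - x n) * y n"]
      by (simp add: algebra_simps)
  qed
qed

lemma padic_cauchy_cmult:
  "prime p \<Longrightarrow> x \<in> carrier (padic_cauchy p) \<Longrightarrow> (\<lambda>k. c * x k) \<in> carrier (padic_cauchy p)"
  using padic_cauchy_mult[of p "\<lambda>_. c" x] by simp

lemma padic_cauchy_cring:
  assumes p: "prime p"
  shows "cring (padic_cauchy p)"
proof (rule cringI)
  show "abelian_group (padic_cauchy p)"
  proof (rule abelian_groupI)
    fix x assume x: "x \<in> carrier (padic_cauchy p)"
    then show "\<exists>y\<in>carrier (padic_cauchy p). y \<oplus>\<^bsub>padic_cauchy p\<^esub> x = \<zero>\<^bsub>padic_cauchy p\<^esub>"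
      using padic_cauchy_cmult[OF p x, of "- 1"] by (intro bexI[of _ "\<lambda>k. - x k"]) auto
  qed (auto simp: padic_cauchy_add p algebra_simps)
  show "comm_monoid (padic_cauchy p)"
    by (rule comm_monoidI) (auto simp: padic_cauchy_mult p algebra_simps)
qed (auto simp: algebra_simps)

section \<open>The ideal of null sequences\<close>

lemma padic_null_subset_cauchy:
  assumes p: "prime p"
  shows "padic_null p \<subseteq> carrier (padic_cauchy p)"
proof
  fix z assume z: "z \<in> padic_null p"
  show "z \<in> carrier (padic_cauchy p)"
    unfolding padic_cauchy_carrier_iff
  proof (intro allI impI)
    fix e :: real assume "e > 0"
    then obtain N where N: "\<And>k. k \<ge> N \<Longrightarrow> rat_absp p (z k) < e"
      using z by (auto simp: padic_null_def LIMSEQ_def)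
    show "\<exists>N. \<forall>m\<ge>N. \<forall>n\<ge>N. rat_absp p (z m - z n) < e"
    proof (intro exI allI impI)
      fix m n assume "m \<ge> N" "n \<ge> N"
      then show "rat_absp p (z m - z n) < e"
        using N[of m] N[of n] rat_absp_add_le[OF p, of "z m" "- z n"] p by simp
    qed
  qed
qed

lemma padic_null_mult:
  assumes p: "prime p" and x: "x \<in> carrier (padic_cauchy p)" and z: "z \<in> padic_null p"
  shows "(\<lambda>k. x k * z k) \<in> padic_null p"
proof -
  obtain B where B: "B > 0" "\<And>k. rat_absp p (x k) \<le> B" using padic_cauchy_bounded[OF p x] by blast
  have "(\<lambda>k. B * rat_absp p (z k)) \<longlonglongrightarrow> 0"
    using tendsto_mult[OF tendsto_const[of B], of "\<lambda>k. rat_absp p (z k)" 0 sequentially] z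
    by (simp add: padic_null_def)
  then have "(\<lambda>k. rat_absp p (x k * z k)) \<longlonglongrightarrow> 0"
    by (rule Lim_null_comparison[rotated]) (auto simp: rat_absp_mult[OF p] B mult_right_mono)
  then show ?thesis by (simp add: padic_null_def)
qed

lemma padic_null_ideal:
  assumes p: "prime p"
  shows "ideal (padic_null p) (padic_cauchy p)"
proof -
  interpret cring "padic_cauchy p" by (rule padic_cauchy_cring[OF p])
  note null_cauchy = subsetD[OF padic_null_subset_cauchy[OF p]]
  show ?thesis
  proof (rule idealI[OF ring_axioms])
    show "subgroup (padic_null p) (add_monoid (padic_cauchy p))"
    proof (rule add.subgroupI)
      show "padic_null p \<subseteq> carrier (padic_cauchy p)" by (rule padic_null_subset_cauchy[OF p])
      have "(\<lambda>k. 0) \<in> padic_null p" by (simp add: padic_null_def)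
      then show "padic_null p \<noteq> {}" by blast
    next
      fix x assume x: "x \<in> padic_null p"
      \<comment> \<open>Negation is multiplication by the constant sequence -1, so closure under
        negation follows from closure under multiplication by Cauchy sequences.\<close>
      have "(\<lambda>k. - 1) \<otimes>\<^bsub>padic_cauchy p\<^esub> x = \<ominus>\<^bsub>padic_cauchy p\<^esub> x"
        using null_cauchy[OF x] padic_cauchy_cmult[OF p, of x "- 1"]
        by (intro minus_equality[symmetric]) auto
      then show "\<ominus>\<^bsub>padic_cauchy p\<^esub> x \<in> padic_null p"
        using padic_null_mult[OF p _ x, of "\<lambda>_. - 1"] by simp
    next
      fix x y assume "x \<in> padic_null p" "y \<in> padic_null p"
      then have "(\<lambda>k. rat_absp p (x k) + rat_absp p (y k)) \<longlonglongrightarrow> 0"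
        using tendsto_add[of "\<lambda>k. rat_absp p (x k)" 0 sequentially "\<lambda>k. rat_absp p (y k)" 0]
        by (simp add: padic_null_def)
      then have "(\<lambda>k. rat_absp p (x k + y k)) \<longlonglongrightarrow> 0"
        by (rule Lim_null_comparison[rotated]) (auto simp: rat_absp_add_le_add[OF p])
      then show "x \<oplus>\<^bsub>padic_cauchy p\<^esub> y \<in> padic_null p" by (simp add: padic_null_def)
    qed
  next
    fix a x assume "a \<in> padic_null p" "x \<in> carrier (padic_cauchy p)"
    then show "x \<otimes>\<^bsub>padic_cauchy p\<^esub> a \<in> padic_null p" "a \<otimes>\<^bsub>padic_cauchy p\<^esub> x \<in> padic_null p"
      using padic_null_mult[OF p, of x a] by (simp_all add: mult.commute)
  qed
qed

section \<open>Classes of Cauchy sequences and their absolute values\<close>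

abbreviation Qp_class :: "nat \<Rightarrow> (nat \<Rightarrow> rat) \<Rightarrow> (nat \<Rightarrow> rat) set" where
  "Qp_class p x \<equiv> padic_null p +>\<^bsub>padic_cauchy p\<^esub> x"

lemma Qp_class_cases:
  assumes "a \<in> carrier (Qp p)"
  obtains x where "x \<in> carrier (padic_cauchy p)" "a = Qp_class p x"
  using assms by (auto simp: Qp_def FactRing_def A_RCOSETS_def')

lemma Qp_class_in_carrier [simp]:
  "x \<in> carrier (padic_cauchy p) \<Longrightarrow> Qp_class p x \<in> carrier (Qp p)"
  by (auto simp: Qp_def FactRing_def A_RCOSETS_def')

lemma Qp_class_ring_hom_cring:
  "prime p \<Longrightarrow> ring_hom_cring (padic_cauchy p) (Qp p) (Qp_class p)"
  unfolding Qp_def by (intro ideal.rcos_ring_hom_cring padic_null_ideal padic_cauchy_cring)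

text \<open>Representatives of one class differ by a null sequence, so their absolute values have
  the same limit. This shows that the description defining \<open>Qp_abs\<close> is met by a unique
  value.\<close>

lemma Qp_abs_class:
  assumes p: "prime p" and lim: "(\<lambda>k. rat_absp p (x k)) \<longlonglongrightarrow> r"
  shows "Qp_abs p (Qp_class p x) = r"
  unfolding Qp_abs_def
proof (rule the_equality)
  have mem: "y \<in> Qp_class p x \<longleftrightarrow> (\<exists>z\<in>padic_null p. y = (\<lambda>k. z k + x k))" for y
    by (auto simp: a_r_coset_def')
  show "\<forall>y\<in>Qp_class p x. (\<lambda>k. rat_absp p (y k)) \<longlonglongrightarrow> r"
  proof
    fix y assume "y \<in> Qp_class p x"
    then obtain z where z: "z \<in> padic_null p" and y: "y = (\<lambda>k. z k + x k)" using mem by blast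
    have "\<bar>rat_absp p (y k) - rat_absp p (x k)\<bar> \<le> rat_absp p (z k)" for k
      using rat_absp_triangle3[OF p, of "y k" "x k"] by (simp add: y)
    then have "\<forall>\<^sub>F k in sequentially. norm (rat_absp p (y k) - rat_absp p (x k)) \<le> rat_absp p (z k)"
      by simp
    then have "(\<lambda>k. rat_absp p (y k) - rat_absp p (x k)) \<longlonglongrightarrow> 0"
      by (rule Lim_null_comparison) (use z in \<open>simp add: padic_null_def\<close>)
    from tendsto_add[OF this lim] show "(\<lambda>k. rat_absp p (y k)) \<longlonglongrightarrow> r" by simp
  qed
  fix s assume s: "\<forall>y\<in>Qp_class p x. (\<lambda>k. rat_absp p (y k)) \<longlonglongrightarrow> s"
  have "x \<in> Qp_class p x"
    unfolding mem by (intro bexI[of _ "\<lambda>_. 0"]) (auto simp: padic_null_def)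
  then show "s = r" using s lim LIMSEQ_unique by blast
qed

lemma Qp_abs_class_tendsto:
  assumes "prime p" "x \<in> carrier (padic_cauchy p)"
  shows "(\<lambda>k. rat_absp p (x k)) \<longlonglongrightarrow> Qp_abs p (Qp_class p x)"
  using padic_cauchy_convergent[OF assms] Qp_abs_class[OF assms(1)] unfolding convergent_def by metis

lemma padic_cauchy_finsum:
  assumes p: "prime p" and "finite A" and "\<And>j. j \<in> A \<Longrightarrow> g j \<in> carrier (padic_cauchy p)"
  shows "finsum (padic_cauchy p) g A = (\<lambda>k. \<Sum>j\<in>A. g j k)"
proof -
  interpret cring "padic_cauchy p" by (rule padic_cauchy_cring[OF p])
  show ?thesis
    using assms(2,3) by (induction A rule: finite_induct) (auto simp: Pi_def)
qed

text \<open>The quotient map is a ring homomorphism and \<open>Qp_of_rat\<close> yields classes of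
  constant sequences, so the matrix product may be computed termwise on representatives.\<close>

lemma Qp_mult_vec_class:
  fixes f :: "rat^'n::finite^'n"
  assumes p: "prime p" and x: "\<And>j. x j \<in> carrier (padic_cauchy p)"
  shows "Qp_mult_vec p f (\<lambda>j. Qp_class p (x j)) i
    = Qp_class p (\<lambda>k. \<Sum>j\<in>UNIV. f $ i $ j * x j k)"
proof -
  interpret h: ring_hom_cring "padic_cauchy p" "Qp p" "Qp_class p"
    by (rule Qp_class_ring_hom_cring[OF p])
  let ?g = "\<lambda>j k. f $ i $ j * x j k"
  have g: "?g j \<in> carrier (padic_cauchy p)" for j by (rule padic_cauchy_cmult[OF p x])
  have mult: "Qp_of_rat p (f $ i $ j) \<otimes>\<^bsub>Qp p\<^esub> Qp_class p (x j) = Qp_class p (?g j)" for j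
    using h.hom_mult[OF padic_cauchy_const x] unfolding padic_cauchy_simps Qp_of_rat_def by (rule sym)
  have "Qp_class p (finsum (padic_cauchy p) ?g UNIV)
      = (\<Oplus>\<^bsub>Qp p\<^esub>j\<in>UNIV. (Qp_class p \<circ> ?g) j)"
    using g by (intro h.hom_finsum) auto
  also have "\<dots> = Qp_mult_vec p f (\<lambda>j. Qp_class p (x j)) i"
    unfolding Qp_mult_vec_def mult comp_def ..
  finally show ?thesis
    unfolding padic_cauchy_finsum[OF p finite g] by (rule sym)
qed

section \<open>Operator norms and matrix entries\<close>

lemma Qp_vec_abs_le_iff: "Qp_vec_abs p v \<le> c \<longleftrightarrow> (\<forall>i. Qp_abs p (v i) \<le> c)"
  by (auto simp: Qp_vec_abs_def)

lemma Qp_abs_le_vec_abs: "Qp_abs p (v i) \<le> Qp_vec_abs p v"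
  by (simp add: Qp_vec_abs_def)

lemma Qp_vec_abs_mult_le:
  fixes f :: "rat^'n::finite^'n"
  assumes p: "prime p" and v: "v \<in> UNIV \<rightarrow> carrier (Qp p)" and v1: "Qp_vec_abs p v = 1"
    and f: "\<And>i j. rat_absp p (f $ i $ j) \<le> B"
  shows "Qp_vec_abs p (Qp_mult_vec p f v) \<le> B"
  unfolding Qp_vec_abs_le_iff
proof
  fix i
  have "\<exists>x. x \<in> carrier (padic_cauchy p) \<and> v j = Qp_class p x" for j
    using v by (metis Qp_class_cases Pi_mem UNIV_I)
  then obtain x where x: "\<And>j. x j \<in> carrier (padic_cauchy p)" and vx: "v = (\<lambda>j. Qp_class p (x j))"
    by metis
  have B: "0 \<le> B" using f[of i i] rat_absp_nonneg order_trans by blast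
  let ?s = "\<lambda>k. \<Sum>j\<in>UNIV. f $ i $ j * x j k"
  interpret h: ring_hom_cring "padic_cauchy p" "Qp p" "Qp_class p"
    by (rule Qp_class_ring_hom_cring[OF p])
  have "finsum (padic_cauchy p) (\<lambda>j k. f $ i $ j * x j k) UNIV \<in> carrier (padic_cauchy p)"
    by (rule h.R.finsum_closed) (auto intro: padic_cauchy_cmult[OF p x])
  then have "?s \<in> carrier (padic_cauchy p)"
    by (subst (asm) padic_cauchy_finsum[OF p]) (auto intro: padic_cauchy_cmult[OF p x])
  then have lim: "(\<lambda>k. rat_absp p (?s k)) \<longlonglongrightarrow> Qp_abs p (Qp_mult_vec p f v i)"
    using Qp_abs_class_tendsto[OF p] Qp_mult_vec_class[OF p x, where f = f and i = i] by (simp add: vx)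
  \<comment> \<open>The terms \<open>rat_absp p (x j k)\<close> have a limit of at most 1, which
    only gives the bound \<open>1 + e\<close> for large \<open>k\<close>. The slack is sent to 0
    afterwards.\<close>
  have le: "Qp_abs p (Qp_mult_vec p f v i) \<le> B * (1 + e)" if e: "e > 0" for e
  proof (rule tendsto_upperbound[OF lim])
    have "\<forall>\<^sub>F k in sequentially. rat_absp p (x j k) < 1 + e" for j
    proof (rule order_tendstoD(2)[OF Qp_abs_class_tendsto[OF p x]])
      show "Qp_abs p (Qp_class p (x j)) < 1 + e"
        using Qp_abs_le_vec_abs[of p v j] v1 e by (simp add: vx)
    qed
    then have "\<forall>\<^sub>F k in sequentially. \<forall>j. rat_absp p (x j k) < 1 + e"
      by (simp add: eventually_all_finite)
    then show "\<forall>\<^sub>F k in sequentially. rat_absp p (?s k) \<le> B * (1 + e)"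
    proof eventually_elim
      case (elim k)
      show ?case
      proof (rule rat_absp_sum_le[OF p])
        fix j show "rat_absp p (f $ i $ j * x j k) \<le> B * (1 + e)"
          unfolding rat_absp_mult[OF p] using f elim B by (intro mult_mono) (auto simp: less_imp_le)
      qed (use B e in auto)
    qed
  qed simp
  have "Qp_abs p (Qp_mult_vec p f v i) \<le> B + e" if e: "e > 0" for e
  proof -
    \<comment> \<open>The slack is \<open>e / (B + 1)\<close> rather than \<open>e / B\<close>,
      since \<open>B\<close> may be 0.\<close>
    have "B * (1 + e / (B + 1)) \<le> B + e"
      using B e by (simp add: field_simps)
    then show ?thesis using le[of "e / (B + 1)"] B e by simp
  qed
  then show "Qp_abs p (Qp_mult_vec p f v i) \<le> B" by (rule field_le_epsilon)
qed

lemma op_norm_Finite_le: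
  fixes f :: "rat^'n::finite^'n"
  assumes p: "prime p" and f: "\<And>i j. rat_absp p (f $ i $ j) \<le> B"
  shows "op_norm (Finite p) f \<le> B"
proof -
  \<comment> \<open>The all-ones vector shows that the supremum ranges over a nonempty set, as an
    upper bound on a real \<open>SUP\<close> requires.\<close>
  have "Qp_abs p (Qp_class p (\<lambda>_. 1)) = 1" by (rule Qp_abs_class[OF p]) (use p in simp)
  then have "(\<lambda>_. Qp_class p (\<lambda>_. 1)) \<in> {v \<in> (UNIV :: 'n set) \<rightarrow> carrier (Qp p). Qp_vec_abs p v = 1}"
    by (auto simp: Qp_vec_abs_def)
  then show ?thesis
    unfolding op_norm.simps by (intro cSUP_least) (blast, use Qp_vec_abs_mult_le[OF p _ _ f] in auto)
qed

text \<open>The vector with a single 1 in position \<open>j\<close> has absolute value 1 and is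
  mapped to column \<open>j\<close> of \<open>f\<close>.\<close>

lemma rat_absp_entry_le_op_norm:
  fixes f :: "rat^'n::finite^'n"
  assumes p: "prime p"
  shows "rat_absp p (f $ i $ j) \<le> op_norm (Finite p) f"
proof -
  define x :: "'n \<Rightarrow> nat \<Rightarrow> rat" where "x = (\<lambda>l k. if l = j then 1 else 0)"
  have x: "x l \<in> carrier (padic_cauchy p)" for l by (simp add: x_def)
  define v where "v = (\<lambda>l. Qp_class p (x l))"
  have "Qp_abs p (v l) = (if l = j then 1 else 0)" for l
    unfolding v_def by (rule Qp_abs_class[OF p]) (use p in \<open>simp add: x_def\<close>)
  then have v1: "Qp_vec_abs p v = 1"
    unfolding Qp_vec_abs_def by (intro Max_eqI) (auto simp: image_iff)
  have "Qp_mult_vec p f v i = Qp_class p (\<lambda>k. \<Sum>l\<in>UNIV. f $ i $ l * x l k)"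
    unfolding v_def by (rule Qp_mult_vec_class[OF p x])
  also have "\<dots> = Qp_class p (\<lambda>k. f $ i $ j)"
    by (simp add: x_def if_distrib cong: if_cong)
  finally have "Qp_abs p (Qp_mult_vec p f v i) = rat_absp p (f $ i $ j)"
    using Qp_abs_class[OF p, of "\<lambda>_. f $ i $ j"] by simp
  then have "rat_absp p (f $ i $ j) \<le> Qp_vec_abs p (Qp_mult_vec p f v)"
    by (metis Qp_abs_le_vec_abs)
  also have "\<dots> \<le> op_norm (Finite p) f"
    unfolding op_norm.simps
  proof (rule cSUP_upper)
    show "v \<in> {v \<in> UNIV \<rightarrow> carrier (Qp p). Qp_vec_abs p v = 1}" using v1 x by (auto simp: v_def)
    \<comment> \<open>Any finite bound on the entries makes the supremum meaningful; the sum of all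
      absolute values is a convenient one.\<close>
    define M where "M = (\<Sum>a\<in>UNIV. \<Sum>b\<in>UNIV. rat_absp p (f $ a $ b))"
    have M: "rat_absp p (f $ a $ b) \<le> M" for a b
    proof -
      have "rat_absp p (f $ a $ b) \<le> (\<Sum>b\<in>UNIV. rat_absp p (f $ a $ b))"
        by (rule member_le_sum) auto
      also have "\<dots> \<le> M"
        unfolding M_def by (rule member_le_sum) (auto intro: sum_nonneg)
      finally show ?thesis .
    qed
    show "bdd_above ((\<lambda>v. Qp_vec_abs p (Qp_mult_vec p f v)) `
        {v \<in> UNIV \<rightarrow> carrier (Qp p). Qp_vec_abs p v = 1})"
      by (rule bdd_aboveI2[of _ _ M]) (use Qp_vec_abs_mult_le[OF p _ _ M] in auto)
  qed
  finally show ?thesis .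
qed

section \<open>The operator norm at the infinite place\<close>

lemma norm_map_matrix_vec_le:
  fixes f :: "rat^'n::finite^'n" and v :: "real^'n"
  assumes f: "\<And>i j. \<bar>of_rat (f $ i $ j)\<bar> \<le> B" and v: "norm v = 1"
  shows "norm (map_matrix of_rat f *v v) \<le> real CARD('n) * real CARD('n) * B"
proof -
  have B0: "0 \<le> B" by (rule order_trans[OF abs_ge_zero f])
  have B: "\<bar>(map_matrix of_rat f *v v) $ i\<bar> \<le> real CARD('n) * B" for i
  proof -
    have "\<bar>(map_matrix of_rat f *v v) $ i\<bar> \<le> (\<Sum>j\<in>UNIV. \<bar>of_rat (f $ i $ j) * v $ j\<bar>)"
      unfolding matrix_vector_mult_def by (simp add: map_matrix_def)
    also have "\<dots> \<le> (\<Sum>j\<in>(UNIV::'n set). B)"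
    proof (rule sum_mono)
      fix j
      have "\<bar>v $ j\<bar> \<le> 1" using component_le_norm_cart[of v j] v by simp
      then have "\<bar>of_rat (f $ i $ j) * v $ j\<bar> \<le> B * 1"
        unfolding abs_mult by (intro mult_mono f B0) auto
      then show "\<bar>of_rat (f $ i $ j) * v $ j\<bar> \<le> B" by simp
    qed
    finally show ?thesis by simp
  qed
  \<comment> \<open>Passing to the l1 norm gives the second factor \<open>CARD('n)\<close>. This
    crude factor later contributes only \<open>2 * ln n\<close>.\<close>
  have "norm (map_matrix of_rat f *v v) \<le> (\<Sum>i\<in>UNIV. \<bar>(map_matrix of_rat f *v v) $ i\<bar>)"
    by (rule norm_le_l1_cart)
  also have "\<dots> \<le> (\<Sum>i\<in>(UNIV::'n set). real CARD('n) * B)"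
    by (rule sum_mono) (rule B)
  finally show ?thesis by simp
qed

lemma op_norm_Infinite_le:
  fixes f :: "rat^'n::finite^'n"
  assumes "\<And>i j. \<bar>of_rat (f $ i $ j)\<bar> \<le> B"
  shows "op_norm Infinite f \<le> real CARD('n) * real CARD('n) * B"
proof -
  have "(axis undefined 1 :: real^'n) \<in> {v. norm v = 1}" by (simp add: norm_axis_1)
  then show ?thesis
    unfolding op_norm.simps
    by (intro cSUP_least) (blast, use norm_map_matrix_vec_le[OF assms] in auto)
qed

lemma abs_entry_le_op_norm:
  fixes f :: "rat^'n::finite^'n"
  shows "\<bar>of_rat (f $ i $ j)\<bar> \<le> op_norm Infinite f"
proof -
  have "(map_matrix of_rat f *v axis j (1::real)) $ i = of_rat (f $ i $ j)"
    by (simp add: matrix_vector_mult_basis column_def map_matrix_def)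
  then have "\<bar>of_rat (f $ i $ j)\<bar> \<le> norm (map_matrix of_rat f *v axis j (1::real))"
    using component_le_norm_cart[of "map_matrix of_rat f *v axis j (1::real)" i] by simp
  also have "\<dots> \<le> op_norm Infinite f"
    unfolding op_norm.simps
  proof (rule cSUP_upper)
    show "(axis j 1 :: real^'n) \<in> {v. norm v = 1}" by (simp add: norm_axis_1)
    define M where "M = (\<Sum>a\<in>UNIV. \<Sum>b\<in>UNIV. \<bar>of_rat (f $ a $ b) :: real\<bar>)"
    have M: "\<bar>of_rat (f $ a $ b) :: real\<bar> \<le> M" for a b
    proof -
      have "\<bar>of_rat (f $ a $ b) :: real\<bar> \<le> (\<Sum>b\<in>UNIV. \<bar>of_rat (f $ a $ b)\<bar>)"
        by (rule member_le_sum) auto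
      also have "\<dots> \<le> M"
        unfolding M_def by (rule member_le_sum) (auto intro: sum_nonneg)
      finally show ?thesis .
    qed
    show "bdd_above ((\<lambda>v::real^'n. norm (map_matrix of_rat f *v v)) ` {v. norm v = 1})"
      by (rule bdd_aboveI2) (use norm_map_matrix_vec_le[OF M] in auto)
  qed
  finally show ?thesis .
qed

section \<open>Products of generators\<close>

text \<open>The real number \<open>k\<close> is an upper bound for the length of some word, not the
  exact length. Bounds can therefore be added, weakened and expressed through logarithms.\<close>

definition has_word ::
    "nat set \<Rightarrow> rat^'n::{finite,linorder}^'n::{finite,linorder} \<Rightarrow> real \<Rightarrow> bool" where
  "has_word P f k \<longleftrightarrow>
     (\<exists>ws. real (length ws) \<le> k \<and> set ws \<subseteq> gens_K P \<and> foldr (**) ws (mat 1) = f)"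

lemma foldr_matrix_mul_append:
  fixes ws vs :: "(rat^'n::finite^'n) list"
  shows "foldr (**) (ws @ vs) (mat 1) = foldr (**) ws (mat 1) ** foldr (**) vs (mat 1)"
  by (induction ws) (simp_all add: matrix_mul_assoc)

lemma has_word_mat_1: "0 \<le> k \<Longrightarrow> has_word P (mat 1) k"
  unfolding has_word_def by (rule exI[of _ "[]"]) simp

lemma has_word_gen: "g \<in> gens_K P \<Longrightarrow> 1 \<le> k \<Longrightarrow> has_word P g k"
  unfolding has_word_def by (rule exI[of _ "[g]"]) simp

lemma has_word_mono: "has_word P f k \<Longrightarrow> k \<le> l \<Longrightarrow> has_word P f l"
  unfolding has_word_def by (erule ex_forward) simp

lemma has_word_mult:
  assumes "has_word P f k" "has_word P g l"
  shows "has_word P (f ** g) (k + l)"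
proof -
  obtain ws vs where "real (length ws) \<le> k" "set ws \<subseteq> gens_K P" "foldr (**) ws (mat 1) = f"
    "real (length vs) \<le> l" "set vs \<subseteq> gens_K P" "foldr (**) vs (mat 1) = g"
    using assms unfolding has_word_def by blast
  then show ?thesis
    unfolding has_word_def
    by (intro exI[of _ "ws @ vs"]) (simp add: foldr_matrix_mul_append del: foldr_append)
qed

lemma word_length_le: "has_word P f k \<Longrightarrow> real (word_length P f) \<le> k"
proof -
  assume "has_word P f k"
  then obtain ws where ws: "real (length ws) \<le> k" "set ws \<subseteq> gens_K P" "foldr (**) ws (mat 1) = f"
    unfolding has_word_def by blast
  then have "word_length P f \<le> length ws"
    unfolding word_length_def by (intro Least_le) blast
  then show ?thesis using ws by linarith
qed

text \<open>Once some word exists, the minimum in \<open>word_length\<close> is attained.\<close>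

lemma has_word_word_length:
  assumes "has_word P f k"
  shows "has_word P f (real (word_length P f))"
proof -
  have "\<exists>k ws. length ws = k \<and> set ws \<subseteq> gens_K P \<and> foldr (**) ws (mat 1) = f"
    using assms unfolding has_word_def by blast
  from LeastI_ex[OF this] obtain ws where "length ws = word_length P f" "set ws \<subseteq> gens_K P"
    "foldr (**) ws (mat 1) = f"
    unfolding word_length_def[symmetric] by blast
  then show ?thesis
    unfolding has_word_def by (intro exI[of _ ws]) simp
qed

section \<open>Elementary matrices\<close>

text \<open>Left multiplication is the row operation that adds \<open>x\<close> times row
  \<open>s\<close> to row \<open>r\<close>.\<close>

lemma theta_offdiag_mult_nth:
  assumes "r \<noteq> s"
  shows "(theta r s x ** A) $ i $ j = A $ i $ j + (if i = r then x * A $ s $ j else 0)"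
proof -
  have "theta r s x $ i $ k * A $ k $ j
      = (if k = i then A $ i $ j else 0) + (if k = s then (if i = r then x * A $ s $ j else 0) else 0)" for k
    using assms by (auto simp: theta_def mat_def)
  then show ?thesis
    by (simp add: matrix_matrix_mult_def sum.distrib)
qed

lemma theta_diag_mult_nth:
  "(theta r r x ** A) $ i $ j = (if i = r then x else 1) * A $ i $ j"
proof -
  have "theta r r x $ i $ k * A $ k $ j
      = (if k = i then (if i = r then x else 1) * A $ i $ j else 0)" for k
    by (auto simp: theta_def mat_def)
  then show ?thesis
    by (simp add: matrix_matrix_mult_def)
qed

lemma theta_offdiag_0: "r \<noteq> s \<Longrightarrow> theta r s 0 = mat 1"
  by (auto simp: vec_eq_iff theta_def mat_def)

lemma theta_diag_1: "theta r r 1 = mat 1"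
  by (auto simp: vec_eq_iff theta_def mat_def)

lemma theta_offdiag_add: "r \<noteq> s \<Longrightarrow> theta r s x ** theta r s y = theta r s (x + y)"
  by (auto simp: vec_eq_iff theta_offdiag_mult_nth) (auto simp: theta_def mat_def)

lemma theta_diag_mult: "theta r r x ** theta r r y = theta r r (x * y)"
  by (auto simp: vec_eq_iff theta_diag_mult_nth) (auto simp: theta_def mat_def)

text \<open>This conjugation relation is the source of all short words: scaling the parameter of an
  elementary matrix costs only diagonal letters.\<close>

lemma theta_diag_offdiag:
  "r \<noteq> s \<Longrightarrow> theta r r x ** theta r s y = theta r s (x * y) ** theta r r x"
  by (auto simp: vec_eq_iff theta_offdiag_mult_nth theta_diag_mult_nth)
    (auto simp: theta_def mat_def)

text \<open>\<open>matrix_inv\<close> is a choice among two-sided inverses; existence makes the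
  choice an inverse and associativity makes it unique.\<close>

lemma matrix_inv_eqI:
  fixes A B :: "rat^'n::finite^'n"
  assumes "A ** B = mat 1" "B ** A = mat 1"
  shows "matrix_inv A = B"
proof -
  have "A ** matrix_inv A = mat 1"
    unfolding matrix_inv_def using assms by (metis (mono_tags, lifting) someI_ex)
  then have "B ** (A ** matrix_inv A) = B" by simp
  then show ?thesis
    using assms by (simp add: matrix_mul_assoc)
qed

lemma matrix_inv_theta_offdiag: "r \<noteq> s \<Longrightarrow> matrix_inv (theta r s x) = theta r s (- x)"
  by (rule matrix_inv_eqI) (simp_all add: theta_offdiag_add theta_offdiag_0)

lemma matrix_inv_theta_diag: "x \<noteq> 0 \<Longrightarrow> matrix_inv (theta r r x) = theta r r (1 / x)"
  by (rule matrix_inv_eqI) (simp_all add: theta_diag_mult theta_diag_1)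

lemma theta_offdiag_in_gens_K: "r < s \<Longrightarrow> e \<in> {1, - 1} \<Longrightarrow> theta r s e \<in> gens_K P"
proof -
  assume rs: "r < s" and e: "e \<in> {1, - 1}"
  have "theta r s 1 \<in> gens_U" "matrix_inv (theta r s 1) \<in> gens_U"
    using rs by (auto simp: gens_U_def)
  then show "theta r s e \<in> gens_K P"
    using rs e by (auto simp: gens_K_def matrix_inv_theta_offdiag)
qed

lemma theta_diag_in_gens_K:
  "p \<in> P \<Longrightarrow> prime p \<Longrightarrow> theta r r (of_nat p) \<in> gens_K P \<and> theta r r (1 / of_nat p) \<in> gens_K P"
proof -
  assume p: "p \<in> P" and "prime p"
  then have "p \<noteq> 0" by auto
  have "theta r r (of_nat p) \<in> gens_J P" "matrix_inv (theta r r (of_nat p)) \<in> gens_J P"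
    using p by (auto simp: gens_J_def)
  then show ?thesis
    using \<open>p \<noteq> 0\<close> by (simp add: gens_K_def matrix_inv_theta_diag)
qed

text \<open>Evaluating the inverses leaves only elementary matrices with explicit parameters.
  Primality gives \<open>p \<noteq> 0\<close>, so \<open>theta r r p\<close> is invertible.\<close>

lemma gens_K_cases:
  assumes "g \<in> gens_K P" "\<forall>p\<in>P. prime p"
  obtains (offdiag) r s e where "r < s" "e \<in> {1, - 1}" "g = theta r s e"
  | (diag) p r x where "p \<in> P" "x \<in> {of_nat p, 1 / of_nat p}" "g = theta r r x"
  using assms(1) unfolding gens_K_def
proof (elim UnE)
  assume "g \<in> gens_U"
  then obtain r s where "r < s" "g = theta r s 1 \<or> g = matrix_inv (theta r s 1)"
    by (auto simp: gens_U_def)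
  then show ?thesis
    using offdiag[of r s 1] offdiag[of r s "- 1"] matrix_inv_theta_offdiag[of r s 1] by auto
next
  assume "g \<in> gens_J P"
  then obtain p r where p: "p \<in> P" and
      g: "g = theta r r (of_nat p) \<or> g = matrix_inv (theta r r (of_nat p))"
    by (auto simp: gens_J_def)
  have "p \<noteq> 0" using bspec[OF assms(2) p] prime_gt_0_nat by blast
  then have "matrix_inv (theta r r (of_nat p)) = theta r r (1 / of_nat p)"
    by (intro matrix_inv_theta_diag) simp
  then show ?thesis
    using p g diag[of p "of_nat p" r] diag[of p "1 / of_nat p" r] by auto
qed

lemma gens_K_inverse:
  assumes g: "g \<in> gens_K P" and P: "\<forall>p\<in>P. prime p"
  obtains g' where "g' \<in> gens_K P" "g ** g' = mat 1" "g' ** g = mat 1"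
  using g P
proof (cases rule: gens_K_cases)
  case (offdiag r s e)
  then have "theta r s (- e) \<in> gens_K P"
    by (intro theta_offdiag_in_gens_K) auto
  with offdiag show ?thesis
    by (intro that[of "theta r s (- e)"]) (auto simp: theta_offdiag_add theta_offdiag_0)
next
  case (diag p r x)
  then have "p \<noteq> 0" using bspec[OF P, of p] prime_gt_0_nat by blast
  have "theta r r (1 / x) \<in> gens_K P"
    using theta_diag_in_gens_K[of p P r] diag P by auto
  with diag \<open>p \<noteq> 0\<close> show ?thesis
    by (intro that[of "theta r r (1 / x)"]) (auto simp: theta_diag_mult theta_diag_1)
qed

text \<open>The generating set is closed under inverses, so reversing a word and inverting its
  letters keeps the length. Every bound proved for words thus also applies to
  \<open>matrix_inv f\<close>.\<close>

lemma has_word_inverse: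
  fixes f :: "rat^'n::{finite,linorder}^'n::{finite,linorder}"
  assumes "has_word P f k" and P: "\<forall>p\<in>P. prime p"
  shows "f ** matrix_inv f = mat 1 \<and> matrix_inv f ** f = mat 1 \<and> has_word P (matrix_inv f) k"
proof -
  have "\<exists>f'. foldr (**) ws (mat 1) ** f' = mat 1 \<and> f' ** foldr (**) ws (mat 1) = mat 1
      \<and> has_word P f' (real (length ws))"
    if "set ws \<subseteq> gens_K P" for ws :: "(rat^'n::{finite,linorder}^'n::{finite,linorder}) list"
    using that
  proof (induction ws)
    case Nil
    then show ?case by (auto intro: exI[of _ "mat 1"] has_word_mat_1)
  next
    case (Cons g ws)
    let ?f = "foldr (**) ws (mat 1)"
    obtain f' where f': "?f ** f' = mat 1" "f' ** ?f = mat 1" "has_word P f' (real (length ws))"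
      using Cons by auto
    obtain g' where g': "g' \<in> gens_K P" "g ** g' = mat 1" "g' ** g = mat 1"
      using gens_K_inverse[OF _ P, of g] Cons.prems by auto
    have "(g ** ?f) ** (f' ** g') = g ** (?f ** f') ** g'"
      "(f' ** g') ** (g ** ?f) = f' ** (g' ** g) ** ?f"
      by (simp_all add: matrix_mul_assoc)
    moreover have "has_word P (f' ** g') (real (length ws) + 1)"
      by (intro has_word_mult f' has_word_gen g') simp
    ultimately show ?case
      using f' g' by (intro exI[of _ "f' ** g'"]) (simp add: add.commute)
  qed
  then obtain f' where f': "f ** f' = mat 1" "f' ** f = mat 1" "has_word P f' k"
    using assms(1) has_word_mono unfolding has_word_def[of P f] by metis
  then show ?thesis using matrix_inv_eqI by metis
qed

lemma FG_has_word:
  assumes f: "f \<in> FG P" and P: "\<forall>p\<in>P. prime p"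
  shows "\<exists>k. has_word P f k"
  using f unfolding FG_def
proof (induction f rule: generate.induct)
  case one
  then show ?case by (auto simp: GL_def intro: has_word_mat_1)
next
  case (incl h)
  then show ?case using has_word_gen by blast
next
  case (inv h)
  obtain g where g: "g \<in> gens_K P" "h ** g = mat 1" "g ** h = mat 1"
    using gens_K_inverse[OF inv P] .
  \<comment> \<open>The group inverse is a definite description over invertible matrices; uniqueness
    of inverses identifies it with the generator \<open>g\<close>.\<close>
  have "inv\<^bsub>GL\<^esub> h = g"
    unfolding m_inv_def
  proof (rule the_equality)
    show "g \<in> carrier GL \<and> h \<otimes>\<^bsub>GL\<^esub> g = \<one>\<^bsub>GL\<^esub> \<and> g \<otimes>\<^bsub>GL\<^esub> h = \<one>\<^bsub>GL\<^esub>"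
      using g by (auto simp: GL_def invertible_def)
    fix y assume "y \<in> carrier GL \<and> h \<otimes>\<^bsub>GL\<^esub> y = \<one>\<^bsub>GL\<^esub> \<and> y \<otimes>\<^bsub>GL\<^esub> h = \<one>\<^bsub>GL\<^esub>"
    then have "g ** (h ** y) = g" by (simp add: GL_def)
    then show "y = g" using g by (simp add: matrix_mul_assoc)
  qed
  then show ?case using g has_word_gen by blast
next
  case (eng h1 h2)
  then show ?case using has_word_mult by (fastforce simp: GL_def)
qed

section \<open>Short words\<close>

text \<open>Since \<open>ln 2\<close> is at least 2/3, a single diagonal letter for \<open>p\<close>
  can be charged to \<open>2 * ln p\<close>.\<close>

lemma one_le_two_ln:
  assumes "prime (p::nat)"
  shows "1 \<le> 2 * ln (real p)"
proof -
  have "ln 2 \<le> ln (real p)" using prime_ge_2_nat[OF assms] by simp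
  then show ?thesis using ln2_ge_two_thirds by linarith
qed

text \<open>One letter per prime factor of \<open>b\<close>, counted with multiplicity; the charges
  \<open>2 * ln p\<close> add up to \<open>2 * ln b\<close>.\<close>

lemma has_word_theta_diag:
  fixes r :: "'n::{finite,linorder}"
  assumes P: "\<forall>p\<in>P. prime p" and "b > 0" and "prime_factors b \<subseteq> P"
  shows "has_word P (theta r r (of_nat b)) (2 * ln (real b))
    \<and> has_word P (theta r r (1 / of_nat b)) (2 * ln (real b))"
  using assms(2,3)
proof (induction b rule: prime_divisors_induct)
  case (factor p b)
  then have b: "b > 0" and p: "p \<in> P" and sub: "prime_factors b \<subseteq> P"
    by (auto simp: prime_factorization_mult prime_factorization_prime)
  note IH = "factor.IH"[OF b sub]
  have len: "2 * ln (real (p * b)) = 2 * ln (real p) + 2 * ln (real b)"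
    using b prime_gt_0_nat[OF factor(1)] by (simp add: ln_mult)
  have gen: "has_word P (theta r r (of_nat p)) (2 * ln (real p))"
    "has_word P (theta r r (1 / of_nat p)) (2 * ln (real p))"
    using theta_diag_in_gens_K[OF p factor(1), of r] one_le_two_ln[OF factor(1)] by (auto intro: has_word_gen)
  show ?case
    using has_word_mult[OF gen(1) conjunct1[OF IH]] has_word_mult[OF gen(2) conjunct2[OF IH]]
    unfolding len theta_diag_mult by simp
qed (auto simp: theta_diag_1 intro: has_word_mat_1)

text \<open>The cost is linear in \<open>c\<close>, which is harmless because it is applied only to
  digits below the fixed base \<open>p\<close>.\<close>

lemma has_word_theta_offdiag_nat:
  fixes r s :: "'n::{finite,linorder}"
  assumes "r < s" "e \<in> {1, - 1}"
  shows "has_word P (theta r s (e * of_nat c)) (real c)"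
proof (induction c)
  case 0
  then show ?case using assms by (simp add: theta_offdiag_0 has_word_mat_1)
next
  case (Suc c)
  have "has_word P (theta r s e) 1"
    using assms by (intro has_word_gen theta_offdiag_in_gens_K) auto
  from has_word_mult[OF this Suc] show ?case
    using assms by (simp add: theta_offdiag_add distrib_left)
qed

lemma has_word_theta_diag_inverse_power:
  assumes "p \<in> P" "prime p"
  shows "has_word P (theta r r (1 / of_nat p ^ k)) (real k)"
proof (induction k)
  case (Suc k)
  have "has_word P (theta r r (1 / of_nat p)) 1"
    using theta_diag_in_gens_K[OF assms] by (intro has_word_gen) auto
  from has_word_mult[OF this Suc] show ?case by (simp add: theta_diag_mult)
qed (simp add: theta_diag_1 has_word_mat_1)

text \<open>Horner's scheme in base \<open>p\<close>: multiplying by \<open>p\<close> is conjugation by \<open>theta r r p\<close>, and the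
  conjugating power is only undone once at the end.\<close>

lemma has_word_horner:
  fixes r s :: "'n::{finite,linorder}"
  assumes p: "p \<in> P" "prime p" and rs: "r < s" and e: "e \<in> {1, - 1}"
  shows "\<exists>k. (k = 0 \<or> 2 ^ k \<le> 2 * a) \<and>
    has_word P (theta r s (e * of_nat a) ** theta r r (of_nat p ^ k)) (real (k * (p + 1)))"
proof (induction a rule: less_induct)
  case (less a)
  have rs': "r \<noteq> s" using rs by simp
  show ?case
  proof (cases "a = 0")
    case True
    then show ?thesis
      using rs' by (intro exI[of _ 0]) (simp add: theta_offdiag_0 theta_diag_1 has_word_mat_1)
  next
    case False
    define a' c where "a' = a div p" and "c = a mod p"
    have p2: "p \<ge> 2" using p by (simp add: prime_ge_2_nat)
    have ac: "a = p * a' + c" "c < p" "a' < a" using p2 False by (auto simp: a'_def c_def)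
    obtain k where k: "k = 0 \<or> 2 ^ k \<le> 2 * a'" and
      w: "has_word P (theta r s (e * of_nat a') ** theta r r (of_nat p ^ k)) (real (k * (p + 1)))"
      using less[OF ac(3)] by blast
    \<comment> \<open>One more digit at least doubles the bound because \<open>p\<close> is at least
      2. For \<open>k = 0\<close> nothing is known about \<open>a'\<close>, and \<open>a > 0\<close>
      suffices.\<close>
    have "2 ^ Suc k \<le> 2 * a"
    proof (cases "k = 0")
      case False
      then have "2 ^ Suc k \<le> 2 * (2 * a')" using k by simp
      also have "2 * a' \<le> p * a'" using p2 by simp
      finally show ?thesis unfolding ac(1) by simp
    qed (use \<open>a \<noteq> 0\<close> in simp)
    \<comment> \<open>With \<open>a = p * a' + c\<close>, moving the new letter
      \<open>theta r r p\<close> to the right multiplies \<open>a'\<close> by \<open>p\<close> and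
      merges with \<open>p ^ k\<close>. The digit \<open>c\<close> is then added in front.\<close>
    have *: "theta r s (e * of_nat a) ** theta r r (of_nat p ^ Suc k)
      = theta r s (e * of_nat c) **
        (theta r r (of_nat p) ** (theta r s (e * of_nat a') ** theta r r (of_nat p ^ k)))"
      (is "?L = ?R")
    proof -
      have "?R = theta r s (e * of_nat c) ** (theta r r (of_nat p) ** theta r s (e * of_nat a'))
          ** theta r r (of_nat p ^ k)"
        by (simp add: matrix_mul_assoc)
      also have "\<dots> = (theta r s (e * of_nat c) ** theta r s (of_nat p * (e * of_nat a')))
          ** (theta r r (of_nat p) ** theta r r (of_nat p ^ k))"
        unfolding theta_diag_offdiag[OF rs'] by (simp add: matrix_mul_assoc)
      also have "\<dots> = ?L"
        unfolding theta_diag_mult theta_offdiag_add[OF rs'] by (simp add: ac(1) algebra_simps)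
      finally show ?thesis ..
    qed
    have "has_word P (theta r r (of_nat p)) 1"
      using theta_diag_in_gens_K[OF p] by (intro has_word_gen) auto
    from has_word_mult[OF has_word_theta_offdiag_nat[OF rs e, of P c] has_word_mult[OF this w]]
    have "has_word P ?L (real c + (1 + real (k * (p + 1))))" unfolding * .
    \<comment> \<open>A step uses \<open>c\<close> letters for the digit and one for the
      conjugation, and \<open>c < p\<close>.\<close>
    then have "has_word P ?L (real (Suc k * (p + 1)))"
      by (rule has_word_mono) (use ac(2) in simp)
    then show ?thesis using \<open>2 ^ Suc k \<le> 2 * a\<close> by blast
  qed
qed

text \<open>The numerator takes \<open>k * (p + 2)\<close> letters with
  \<open>k \<le> 1 + 2 * H\<close>: Horner's scheme takes \<open>k * (p + 1)\<close>, and undoing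
  its diagonal power takes \<open>k\<close>. Conjugating by the denominator adds
  \<open>2 * H\<close> on each side.\<close>

lemma has_word_theta_offdiag:
  fixes r s :: "'n::{finite,linorder}"
  assumes P: "\<forall>p\<in>P. prime p" and p: "p \<in> P" and rs: "r < s"
    and b: "b > 0" "prime_factors b \<subseteq> P"
    and H: "0 \<le> H" "ln (real b) \<le> H" "a \<noteq> 0 \<Longrightarrow> ln \<bar>real_of_int a\<bar> \<le> H"
  shows "has_word P (theta r s (of_int a / of_nat b)) ((1 + 2 * H) * (real p + 2) + 4 * H)"
proof -
  have pp: "prime p" using P p by blast
  have p0: "p > 0" using pp by (rule prime_gt_0_nat)
  have rs': "r \<noteq> s" using rs by simp
  \<comment> \<open>Horner's scheme works on natural numbers, so the sign of \<open>a\<close> is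
    moved into the off-diagonal letter.\<close>
  define e :: rat where "e = (if a \<ge> 0 then 1 else - 1)"
  define m where "m = nat \<bar>a\<bar>"
  have am: "of_int a = e * of_nat m" by (simp add: e_def m_def)
  have e: "e \<in> {1, - 1}" by (simp add: e_def)
  obtain k where k: "k = 0 \<or> 2 ^ k \<le> 2 * m" and
    w: "has_word P (theta r s (e * of_nat m) ** theta r r (of_nat p ^ k)) (real (k * (p + 1)))"
    using has_word_horner[OF p pp rs e] by blast
  \<comment> \<open>Taking logarithms of \<open>2 ^ k \<le> 2 * m\<close> gives
    \<open>(k - 1) * ln 2 \<le> H\<close>, and \<open>ln 2\<close> exceeds 1/2. If
    \<open>m = 0\<close>, then \<open>k = 0\<close>.\<close>
  have kH: "real k \<le> 1 + 2 * H"
  proof (cases "k = 0")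
    case False
    then have "2 ^ k \<le> 2 * m" using k by simp
    then have "m > 0" by (intro Nat.gr0I) simp
    have "2 ^ k \<le> 2 * real m" using \<open>2 ^ k \<le> 2 * m\<close> by (metis of_nat_le_iff of_nat_mult of_nat_numeral of_nat_power)
    then have "ln (2 ^ k) \<le> ln (2 * real m)" using \<open>m > 0\<close> by (subst ln_le_cancel_iff) auto
    then have "real k * ln 2 \<le> ln 2 + ln (real m)"
      using \<open>m > 0\<close> by (simp add: ln_mult ln_realpow)
    moreover have "ln (real m) \<le> H" using H(3) \<open>m > 0\<close> by (simp add: m_def)
    ultimately have "(real k - 1) * ln 2 \<le> H" by (simp add: algebra_simps)
    moreover have "(real k - 1) * (1 / 2) \<le> (real k - 1) * ln 2"
      using ln2_ge_two_thirds False by (intro mult_left_mono) auto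
    ultimately show ?thesis by simp
  qed (use H in simp)
  have "has_word P (theta r s (of_int a)) (real (k * (p + 1)) + real k)"
  proof -
    have "theta r s (e * of_nat m) ** theta r r (of_nat p ^ k) ** theta r r (1 / of_nat p ^ k)
        = theta r s (of_int a)"
      using p0 unfolding matrix_mul_assoc[symmetric] theta_diag_mult am by (simp add: theta_diag_1)
    then show ?thesis
      using has_word_mult[OF w has_word_theta_diag_inverse_power[OF p pp, of r k]] by simp
  qed
  then have wa: "has_word P (theta r s (of_int a)) ((1 + 2 * H) * (real p + 2))"
  proof (rule has_word_mono)
    have "real (k * (p + 1)) + real k = real k * (real p + 2)" by (simp add: algebra_simps)
    also have "\<dots> \<le> (1 + 2 * H) * (real p + 2)" using kH by (intro mult_right_mono) auto
    finally show "real (k * (p + 1)) + real k \<le> (1 + 2 * H) * (real p + 2)" .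
  qed
  \<comment> \<open>Conjugation by the diagonal matrix of \<open>1 / b\<close> divides the parameter
    by \<open>b\<close>.\<close>
  have "theta r r (1 / of_nat b) ** theta r s (of_int a) ** theta r r (of_nat b)
      = theta r s (of_int a / of_nat b)"
    unfolding theta_diag_offdiag[OF rs'] matrix_mul_assoc[symmetric] theta_diag_mult
    using b by (simp add: theta_diag_1)
  then have "has_word P (theta r s (of_int a / of_nat b))
      (2 * ln (real b) + (1 + 2 * H) * (real p + 2) + 2 * ln (real b))"
    using has_word_mult[OF has_word_mult[OF conjunct2[OF has_word_theta_diag[OF P b, of r]] wa]
        conjunct1[OF has_word_theta_diag[OF P b, of r]]] by simp
  then show ?thesis by (rule has_word_mono) (use H in simp)
qed

section \<open>Factoring triangular matrices\<close>

lemma has_word_unipotent: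
  fixes A :: "rat^'n::{finite,linorder}^'n::{finite,linorder}"
  assumes c: "0 \<le> c" and diag: "\<And>i. A $ i $ i = 1" and low: "\<And>i j. j < i \<Longrightarrow> A $ i $ j = 0"
    and w: "\<And>r s. r < s \<Longrightarrow> has_word P (theta r s (A $ r $ s)) c"
  shows "has_word P A (real (card {(i, j). i < j \<and> A $ i $ j \<noteq> 0}) * c)"
  using diag low w
proof (induction "card {(i, j). i < j \<and> A $ i $ j \<noteq> 0}" arbitrary: A)
  case 0
  have E: "{(i, j). i < j \<and> A $ i $ j \<noteq> 0} = {}"
    using "0.hyps"[symmetric] unfolding card_0_eq[OF finite] .
  have "A = mat 1"
    unfolding vec_eq_iff mat_def
  proof (intro allI)
    fix i j show "A $ i $ j = (\<chi> i j. if i = j then 1 else 0) $ i $ j"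
      using E "0.prems"(1,2) by (cases i j rule: linorder_cases) auto
  qed
  then show ?case using c by (simp add: has_word_mat_1)
next
  case (Suc m)
  let ?E = "\<lambda>A :: rat^'n::{finite,linorder}^'n::{finite,linorder}. {(i, j). i < j \<and> A $ i $ j \<noteq> 0}"
  have "card (?E A) \<noteq> 0" using Suc.hyps(2) by linarith
  then have ne: "?E A \<noteq> {}" unfolding card_0_eq[OF finite] .
  \<comment> \<open>Choosing the rightmost column with a nonzero entry above the diagonal forces row
    \<open>s\<close> to be a unit row. The row operation then restores only entry
    \<open>(r, s)\<close>, so the factors carry the original entries of \<open>A\<close> as
    parameters.\<close>
  define s where "s = Max (snd ` ?E A)"
  have "s \<in> snd ` ?E A" unfolding s_def using ne by (intro Max_in) auto
  then obtain r where rs: "r < s" "A $ r $ s \<noteq> 0" by auto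
  have s: "j \<le> s" if "(i, j) \<in> ?E A" for i j
    unfolding s_def using that by (intro Max_ge) force+
  define A' where "A' = (\<chi> i j. if i = r \<and> j = s then 0 else A $ i $ j)"
  have E: "?E A' = ?E A - {(r, s)}" by (auto simp: A'_def)
  have row: "A' $ s $ j = (if j = s then 1 else 0)" for j
  proof (cases j s rule: linorder_cases)
    case greater
    then have "(s, j) \<notin> ?E A" using s[of s j] by force
    then show ?thesis using greater by (simp add: A'_def)
  qed (use Suc.prems(1)[of s] Suc.prems(2)[of j s] rs in \<open>auto simp: A'_def\<close>)
  have eq: "theta r s (A $ r $ s) ** A' = A"
    using rs by (auto simp: vec_eq_iff theta_offdiag_mult_nth row) (auto simp: A'_def)
  have wA': "has_word P A' (real (card (?E A')) * c)"
  proof (rule Suc.hyps(1))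
    show "m = card (?E A')" unfolding E using Suc.hyps(2) rs by (subst card_Diff_singleton) auto
  next
    fix i show "A' $ i $ i = 1" using Suc.prems(1) rs by (auto simp: A'_def)
  next
    fix i j :: 'n assume "j < i"
    then show "A' $ i $ j = 0" using Suc.prems(2) by (auto simp: A'_def)
  next
    fix i j :: 'n assume "i < j"
    then show "has_word P (theta i j (A' $ i $ j)) c"
      using Suc.prems(3) c by (auto simp: A'_def theta_offdiag_0 has_word_mat_1)
  qed
  have "has_word P A (c + real (card (?E A')) * c)"
    using has_word_mult[OF Suc.prems(3)[OF rs(1)] wA'] unfolding eq .
  moreover have "c + real (card (?E A')) * c = real (card (?E A)) * c"
  proof -
    have "card (?E A) = Suc (card (?E A'))"
      unfolding E using rs by (intro card.remove) auto
    then show ?thesis by (simp add: algebra_simps)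
  qed
  ultimately show ?case by simp
qed

text \<open>The diagonal factor is a product of matrices \<open>theta i i (d i)\<close>; the
  induction runs over the set of rows already scaled.\<close>

lemma has_word_scale_rows:
  fixes N :: "rat^'n::{finite,linorder}^'n::{finite,linorder}"
  assumes w: "\<And>i. has_word P (theta i i (d i)) c" and N: "has_word P N k"
  shows "has_word P (\<chi> i j. d i * N $ i $ j) (real CARD('n) * c + k)"
proof -
  have "has_word P (\<chi> i j. (if i \<in> S then d i else 1) * N $ i $ j) (real (card S) * c + k)" for S
    using finite[of S]
  proof (induction S rule: finite_induct)
    case empty
    then show ?case using N by simp
  next
    case (insert l S)
    have "theta l l (d l) ** (\<chi> i j. (if i \<in> S then d i else 1) * N $ i $ j)
        = (\<chi> i j. (if i \<in> insert l S then d i else 1) * N $ i $ j)"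
      using insert by (auto simp: vec_eq_iff theta_diag_mult_nth)
    then show ?case
      using has_word_mult[OF w insert.IH, of l] insert by (simp add: algebra_simps)
  qed
  from this[of UNIV] show ?thesis by simp
qed

section \<open>Entries of elements of \<open>FG P\<close>\<close>

text \<open>An invariant of words. Absolute value exactly 1 on the diagonal makes the numerators of
  diagonal entries, as well as their denominators, products of primes in \<open>P\<close>.\<close>

definition triangular_P_integral ::
    "nat set \<Rightarrow> rat^'n::{finite,linorder}^'n::{finite,linorder} \<Rightarrow> bool" where
  "triangular_P_integral P f \<longleftrightarrow>
     (\<forall>i j. j < i \<longrightarrow> f $ i $ j = 0) \<and>
     (\<forall>i. f $ i $ i > 0 \<and> (\<forall>q. prime q \<and> q \<notin> P \<longrightarrow> rat_absp q (f $ i $ i) = 1)) \<and>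
     (\<forall>q i j. prime q \<and> q \<notin> P \<longrightarrow> rat_absp q (f $ i $ j) \<le> 1)"

lemma rat_absp_mat_1: "prime q \<Longrightarrow> rat_absp q (mat 1 $ i $ j) \<le> 1"
  by (simp add: mat_def)

lemma triangular_P_integral_mat_1: "triangular_P_integral P (mat 1)"
  unfolding triangular_P_integral_def by (auto simp: mat_def)

text \<open>Nonzero entries of generators are 1, -1, \<open>p\<close> or \<open>1 / p\<close>; only
  \<open>1 / p\<close> has an absolute value above 1, and only at \<open>p\<close> itself.\<close>

lemma rat_absp_gens_K:
  assumes g: "g \<in> gens_K P" and P: "\<forall>p\<in>P. prime p" and q: "prime q"
  shows "rat_absp q (g $ i $ j) \<le> (if q \<in> P then real q else 1)"
  using g P
proof (cases rule: gens_K_cases)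
  case (offdiag r s e)
  then have "g $ i $ j \<in> {1, - 1, 0}" by (auto simp: theta_def mat_def)
  then show ?thesis using q prime_ge_1_nat[OF q] by auto
next
  case (diag p r x)
  then have p: "prime p" using P by blast
  have q1: "1 \<le> real q" using prime_ge_1_nat[OF q] by simp
  have "1 / real q \<le> 1" using q1 by simp
  moreover from this q1 have "1 / real q \<le> real q" by (rule order_trans)
  moreover have "rat_absp q x \<in> {rat_absp q (of_nat p), inverse (rat_absp q (of_nat p))}"
    using diag(2) rat_absp_inverse[OF q, of "of_nat p"] by (auto simp: inverse_eq_divide)
  ultimately have "rat_absp q x \<le> (if q \<in> P then real q else 1)"
    using diag(1) q1 unfolding rat_absp_of_nat_prime[OF q p] by (auto split: if_splits)
  moreover have "g $ i $ j \<in> {x, 1, 0}" using diag by (auto simp: theta_def mat_def)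
  ultimately show ?thesis using q q1 by auto
qed

lemma triangular_P_integral_gens_K_mult:
  fixes f :: "rat^'n::{finite,linorder}^'n::{finite,linorder}"
  assumes g: "g \<in> gens_K P" and P: "\<forall>p\<in>P. prime p" and f: "triangular_P_integral P f"
  shows "triangular_P_integral P (g ** f)"
proof -
  have low: "f $ i $ j = 0" if "j < i" for i j
    using f that by (simp add: triangular_P_integral_def)
  have diag: "f $ i $ i > 0" "prime q \<Longrightarrow> q \<notin> P \<Longrightarrow> rat_absp q (f $ i $ i) = 1" for i q
    using f by (simp_all add: triangular_P_integral_def)
  have int: "rat_absp q (f $ i $ j) \<le> 1" if "prime q" "q \<notin> P" for q i j
    using f that by (simp add: triangular_P_integral_def)
  have int': "rat_absp q ((g ** f) $ i $ j) \<le> 1" if q: "prime q" "q \<notin> P" for q i j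
    unfolding matrix_matrix_mult_def vec_lambda_beta
  proof (rule rat_absp_sum_le[OF q(1)])
    fix k
    have "rat_absp q (g $ i $ k) * rat_absp q (f $ k $ j) \<le> 1 * 1"
      using rat_absp_gens_K[OF g P q(1), of i k] q(2) int[OF q] by (intro mult_mono) auto
    then show "rat_absp q (g $ i $ k * f $ k $ j) \<le> 1" by (simp add: rat_absp_mult[OF q(1)])
  qed auto
  from g P show ?thesis
  proof (cases rule: gens_K_cases)
    case (offdiag r s e)
    then have "(g ** f) $ i $ j = f $ i $ j + (if i = r then e * f $ s $ j else 0)" for i j
      by (simp add: theta_offdiag_mult_nth)
    \<comment> \<open>Row \<open>s\<close> vanishes in all columns up to \<open>r\<close>, since
      \<open>r < s\<close>; adding it to row \<open>r\<close> leaves the diagonal and everything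
      below unchanged.\<close>
    then have "(g ** f) $ i $ j = f $ i $ j" if "j \<le> i" for i j
      using low[of j s] offdiag(1) that by auto
    then show ?thesis
      unfolding triangular_P_integral_def using low diag int' by auto
  next
    case (diag p r x)
    then have p: "prime p" using P by blast
    have x: "x > 0" using diag prime_gt_0_nat[OF p] by auto
    have xq: "rat_absp q x = 1" if "prime q" "q \<notin> P" for q
      using diag that rat_absp_of_nat_prime[OF _ p, of q] rat_absp_inverse[of q "of_nat p"]
      by (auto simp: inverse_eq_divide)
    have "(g ** f) $ i $ j = (if i = r then x else 1) * f $ i $ j" for i j
      using diag by (simp add: theta_diag_mult_nth)
    then show ?thesis
      unfolding triangular_P_integral_def using low \<open>\<And>i. f $ i $ i > 0\<close> int' x xq
        \<open>\<And>i q. prime q \<Longrightarrow> q \<notin> P \<Longrightarrow> rat_absp q (f $ i $ i) = 1\<close>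
      by (auto simp: rat_absp_mult)
  qed
qed

lemma has_word_triangular_P_integral:
  fixes f :: "rat^'n::{finite,linorder}^'n::{finite,linorder}"
  assumes "has_word P f k" and P: "\<forall>p\<in>P. prime p"
  shows "triangular_P_integral P f"
proof -
  have "triangular_P_integral P (foldr (**) ws (mat 1))" if "set ws \<subseteq> gens_K P"
    for ws :: "(rat^'n::{finite,linorder}^'n::{finite,linorder}) list"
    using that
    by (induction ws) (auto intro: triangular_P_integral_mat_1 triangular_P_integral_gens_K_mult[OF _ P])
  then show ?thesis using assms(1) unfolding has_word_def by blast
qed

section \<open>Growth of entries along a word\<close>

lemma abs_gens_K:
  assumes g: "g \<in> gens_K P" and P: "\<forall>p\<in>P. prime p" and m: "\<forall>p\<in>P. p \<le> m" "1 \<le> m"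
  shows "\<bar>g $ i $ j\<bar> \<le> of_nat m"
  using g P
proof (cases rule: gens_K_cases)
  case (offdiag r s e)
  then have "g $ i $ j \<in> {1, - 1, 0}" by (auto simp: theta_def mat_def)
  then show ?thesis using m by auto
next
  case (diag p r x)
  then have p: "1 \<le> p" "p \<le> m" using P m prime_ge_1_nat by auto
  then have "1 / of_nat p \<le> (1 :: rat)" by simp
  also have "(1 :: rat) \<le> of_nat m" using m by simp
  finally have "\<bar>x\<bar> \<le> of_nat m" using diag(2) p by auto
  moreover have "g $ i $ j \<in> {x, 1, 0}" using diag by (auto simp: theta_def mat_def)
  ultimately show ?thesis using m by auto
qed

text \<open>Each letter multiplies the largest absolute value by at most \<open>q\<close>; the
  strong triangle inequality avoids a factor for the number of summands.\<close>

lemma has_word_rat_absp_le: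
  fixes f :: "rat^'n::{finite,linorder}^'n::{finite,linorder}"
  assumes w: "has_word P f (real k)" and P: "\<forall>p\<in>P. prime p" and q: "prime q"
  shows "rat_absp q (f $ i $ j) \<le> real q ^ k"
proof -
  have q1: "1 \<le> real q" using prime_ge_1_nat[OF q] by simp
  have "rat_absp q (foldr (**) ws (mat 1) $ i $ j) \<le> real q ^ length ws" if "set ws \<subseteq> gens_K P"
    for ws :: "(rat^'n::{finite,linorder}^'n::{finite,linorder}) list" and i j
    using that
  proof (induction ws arbitrary: i j)
    case Nil
    then show ?case using rat_absp_mat_1[OF q] by simp
  next
    case (Cons g ws)
    have IH: "rat_absp q (foldr (**) ws (mat 1) $ i $ j) \<le> real q ^ length ws" for i j
      by (rule Cons.IH) (use Cons.prems in simp)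
    have g: "g \<in> gens_K P" using Cons.prems by simp
    show ?case
      unfolding foldr.simps comp_def matrix_matrix_mult_def[of g] vec_lambda_beta
    proof (rule rat_absp_sum_le[OF q])
      fix l
      have gl: "rat_absp q (g $ i $ l) \<le> real q"
        using rat_absp_gens_K[OF g P q, of i l] q1 by (auto split: if_splits)
      show "rat_absp q (g $ i $ l * foldr (**) ws (mat 1) $ l $ j) \<le> real q ^ length (g # ws)"
        unfolding rat_absp_mult[OF q] length_Cons power_Suc
        by (rule mult_mono[OF gl IH]) auto
    qed auto
  qed
  moreover obtain ws where ws: "length ws \<le> k" "set ws \<subseteq> gens_K P" "foldr (**) ws (mat 1) = f"
    using w unfolding has_word_def by auto
  ultimately have "rat_absp q (f $ i $ j) \<le> real q ^ length ws" by metis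
  also have "\<dots> \<le> real q ^ k" by (rule power_increasing[OF ws(1) q1])
  finally show ?thesis .
qed

text \<open>At the infinite place an entry of a product is a sum of \<open>CARD('n)\<close> terms,
  so each letter costs the factor \<open>CARD('n) * m\<close>.\<close>

lemma has_word_abs_le:
  fixes f :: "rat^'n::{finite,linorder}^'n::{finite,linorder}"
  assumes w: "has_word P f (real k)" and P: "\<forall>p\<in>P. prime p" and m: "\<forall>p\<in>P. p \<le> m" "1 \<le> m"
  shows "\<bar>f $ i $ j\<bar> \<le> of_nat (CARD('n) * m) ^ k"
proof -
  let ?M = "of_nat (CARD('n) * m) :: rat"
  have "1 \<le> CARD('n) * m" using m(2) by (simp add: Suc_leI)
  then have M1: "1 \<le> ?M" by (metis of_nat_1 of_nat_le_iff)
  have "\<bar>foldr (**) ws (mat 1) $ i $ j\<bar> \<le> ?M ^ length ws" if "set ws \<subseteq> gens_K P"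
    for ws :: "(rat^'n::{finite,linorder}^'n::{finite,linorder}) list" and i j
    using that
  proof (induction ws arbitrary: i j)
    case Nil
    then show ?case by (simp add: mat_def)
  next
    case (Cons g ws)
    have IH: "\<bar>foldr (**) ws (mat 1) $ i $ j\<bar> \<le> ?M ^ length ws" for i j
      by (rule Cons.IH) (use Cons.prems in simp)
    have g: "g \<in> gens_K P" using Cons.prems by simp
    have "\<bar>\<Sum>l\<in>UNIV. g $ i $ l * foldr (**) ws (mat 1) $ l $ j\<bar>
        \<le> (\<Sum>l\<in>UNIV. \<bar>g $ i $ l * foldr (**) ws (mat 1) $ l $ j\<bar>)"
      by (rule sum_abs)
    also have "\<dots> \<le> (\<Sum>l\<in>(UNIV::'n set). of_nat m * ?M ^ length ws)"
      unfolding abs_mult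
      by (intro sum_mono mult_mono abs_gens_K[OF g P m] IH) auto
    also have "\<dots> = ?M ^ length (g # ws)" by simp
    finally show ?case
      unfolding foldr.simps comp_def matrix_matrix_mult_def[of g] vec_lambda_beta .
  qed
  moreover obtain ws where ws: "length ws \<le> k" "set ws \<subseteq> gens_K P" "foldr (**) ws (mat 1) = f"
    using w unfolding has_word_def by auto
  ultimately have "\<bar>f $ i $ j\<bar> \<le> ?M ^ length ws" by metis
  also have "\<dots> \<le> ?M ^ k" by (rule power_increasing[OF ws(1) M1])
  finally show ?thesis .
qed

section \<open>Comparison of the two lengths\<close>

lemma ln_plus_nonneg [simp]: "0 \<le> ln_plus x"
  by (simp add: ln_plus_def)

lemma ln_plus_mono: "0 \<le> x \<Longrightarrow> x \<le> y \<Longrightarrow> ln_plus x \<le> ln_plus y"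
  \<comment> \<open>The value 0 is treated apart because monotonicity of \<open>ln\<close> concerns
    positive arguments.\<close>
  by (cases "x = 0") (auto simp: ln_plus_def max_def)

lemma ln_le_ln_plus: "0 < x \<Longrightarrow> x \<le> y \<Longrightarrow> ln x \<le> ln_plus y"
  using ln_plus_mono[of x y] by (simp add: ln_plus_def)

lemma op_norm_nonneg:
  fixes f :: "rat^'n::finite^'n"
  assumes "v \<in> places"
  shows "0 \<le> op_norm v f"
proof (cases v)
  case (Finite p)
  then have "prime p" using assms by (auto simp: places_def)
  from rat_absp_entry_le_op_norm[OF this, of f] show ?thesis
    unfolding Finite using rat_absp_nonneg order_trans by blast
next
  case Infinite
  then show ?thesis using abs_entry_le_op_norm[of f] abs_ge_zero order_trans by metis
qed

text \<open>The share of \<open>f\<close> alone, without its inverse, as a finite sum. The lower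
  bound on word length uses it for both \<open>f\<close> and its inverse, the upper bound for
  \<open>f\<close> only.\<close>

definition half_adelic_length :: "nat set \<Rightarrow> rat^'n::finite^'n \<Rightarrow> real" where
  "half_adelic_length P f = ln_plus (op_norm Infinite f) + (\<Sum>p\<in>P. ln_plus (op_norm (Finite p) f))"

lemma half_adelic_length_nonneg: "0 \<le> half_adelic_length P f"
  unfolding half_adelic_length_def by (intro add_nonneg_nonneg sum_nonneg) auto

text \<open>At a prime outside \<open>P\<close> both \<open>f\<close> and its inverse are words with
  integral entries, so their operator norms are at most 1 and \<open>ln_plus\<close>
  vanishes.\<close>

lemma adelic_length_eq:
  fixes f :: "rat^'n::{finite,linorder}^'n::{finite,linorder}"
  assumes w: "has_word P f k" and P: "\<forall>p\<in>P. prime p" "finite P"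
  shows "adelic_length f = half_adelic_length P f + half_adelic_length P (matrix_inv f)"
proof -
  let ?t = "\<lambda>p. ln_plus (op_norm p f) + ln_plus (op_norm p (matrix_inv f))"
  have zero: "ln_plus (op_norm (Finite q) g) = 0"
    if q: "prime q" "q \<notin> P" and g: "has_word P g k"
    for q and g :: "rat^'n::{finite,linorder}^'n::{finite,linorder}"
  proof -
    have "op_norm (Finite q) g \<le> 1"
      using has_word_triangular_P_integral[OF g P(1)] q
      by (intro op_norm_Finite_le) (auto simp: triangular_P_integral_def)
    moreover have "0 \<le> op_norm (Finite q) g" using q by (intro op_norm_nonneg) (simp add: places_def)
    ultimately have "ln_plus (op_norm (Finite q) g) \<le> ln_plus 1" by (rule ln_plus_mono[rotated])
    then show ?thesis using ln_plus_nonneg[of "op_norm (Finite q) g"] by (simp add: ln_plus_def)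
  qed
  have inv: "has_word P (matrix_inv f) k" using has_word_inverse[OF w P(1)] by blast
  have "adelic_length f = infsum ?t (insert Infinite (Finite ` P))"
    unfolding adelic_length_def
  proof (rule infsum_cong_neutral)
    fix v assume "v \<in> places - insert Infinite (Finite ` P)"
    then obtain q where "v = Finite q" "prime q" "q \<notin> P" by (auto simp: places_def)
    then show "?t v = 0" using zero[OF _ _ w] zero[OF _ _ inv] by simp
  qed (use P in \<open>auto simp: places_def\<close>)
  also have "\<dots> = sum ?t (insert Infinite (Finite ` P))"
    using P by (intro infsum_finite) auto
  also have "\<dots> = ?t Infinite + (\<Sum>p\<in>P. ?t (Finite p))"
    using P(2) by (subst sum.insert) (auto simp: sum.reindex inj_on_def)
  finally show ?thesis
    unfolding half_adelic_length_def by (simp add: sum.distrib)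
qed

lemma half_adelic_length_le:
  fixes f :: "rat^'n::{finite,linorder}^'n::{finite,linorder}"
  assumes w: "has_word P f (real k)" and P: "\<forall>p\<in>P. prime p" "finite P"
    and m: "\<forall>p\<in>P. p \<le> m" "1 \<le> m" and k: "1 \<le> k"
  shows "half_adelic_length P f
    \<le> real k * (2 * ln (real CARD('n)) + ln (real (CARD('n) * m)) + (\<Sum>p\<in>P. ln (real p)))"
proof -
  let ?n = "real CARD('n)"
  let ?M = "real (CARD('n) * m)"
  have n1: "1 \<le> ?n" by (simp add: Suc_leI)
  have "1 \<le> CARD('n) * m" using m(2) by (simp add: Suc_leI)
  then have M1: "1 \<le> ?M" by linarith
  have k1: "1 \<le> real k" using k by simp
  have "\<bar>of_rat (f $ i $ j)\<bar> \<le> ?M ^ k" for i j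
  proof -
    have "(of_rat \<bar>f $ i $ j\<bar> :: real) \<le> of_rat (of_nat (CARD('n) * m) ^ k)"
      using has_word_abs_le[OF w P(1) m] by (simp only: of_rat_less_eq)
    then show ?thesis by (simp add: of_rat_power of_rat_mult)
  qed
  then have "op_norm Infinite f \<le> ?n * ?n * ?M ^ k" by (rule op_norm_Infinite_le)
  then have "ln_plus (op_norm Infinite f) \<le> ln_plus (?n * ?n * ?M ^ k)"
    by (intro ln_plus_mono op_norm_nonneg) (simp add: places_def)
  also have "\<dots> = 2 * ln ?n + real k * ln ?M"
  proof -
    have "ln (?n * ?n * ?M ^ k) = 2 * ln ?n + real k * ln ?M"
      using n1 M1 by (simp add: ln_mult ln_realpow del: of_nat_mult)
    moreover have "0 \<le> 2 * ln ?n + real k * ln ?M" using n1 M1 by (intro add_nonneg_nonneg) auto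
    ultimately show ?thesis unfolding ln_plus_def by simp
  qed
  \<comment> \<open>Since \<open>k\<close> is at least 1, the additive term coming from the norm
    comparison is absorbed into the linear one.\<close>
  also have "\<dots> \<le> real k * (2 * ln ?n) + real k * ln ?M"
  proof -
    have "0 \<le> 2 * ln ?n" using n1 by simp
    from mult_right_mono[OF k1 this] show ?thesis by simp
  qed
  finally have inf: "ln_plus (op_norm Infinite f) \<le> real k * (2 * ln ?n) + real k * ln ?M" .
  have "ln_plus (op_norm (Finite p) f) \<le> real k * ln (real p)" if "p \<in> P" for p
  proof -
    have p: "prime p" using P that by blast
    have "op_norm (Finite p) f \<le> real p ^ k"
      by (rule op_norm_Finite_le[OF p has_word_rat_absp_le[OF w P(1) p]])
    then have "ln_plus (op_norm (Finite p) f) \<le> ln_plus (real p ^ k)"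
      using p by (intro ln_plus_mono op_norm_nonneg) (simp_all add: places_def)
    also have "\<dots> = real k * ln (real p)"
      using prime_ge_1_nat[OF p] by (simp add: ln_plus_def ln_realpow)
    finally show ?thesis .
  qed
  then have "(\<Sum>p\<in>P. ln_plus (op_norm (Finite p) f)) \<le> real k * (\<Sum>p\<in>P. ln (real p))"
    unfolding sum_distrib_left by (rule sum_mono)
  with inf show ?thesis
    unfolding half_adelic_length_def by (simp add: distrib_left)
qed

section \<open>Numerators and denominators of the entries\<close>

lemma P_integral_denominator:
  assumes P: "\<forall>p\<in>P. prime p" "finite P" and x: "quotient_of x = (a, b)"
    and int: "\<And>q. prime q \<Longrightarrow> q \<notin> P \<Longrightarrow> rat_absp q x \<le> 1"
  shows "prime_factors (nat b) \<subseteq> P" "real_of_int b \<le> (\<Prod>p\<in>P. max 1 (rat_absp p x))"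
proof -
  have b: "b > 0" using quotient_of_denom_pos[OF x] .
  \<comment> \<open>The absolute value is defined through integer multiplicities, the prime
    factorization through natural ones.\<close>
  have mult: "multiplicity q (nat b) = multiplicity (int q) b" for q
  proof -
    have "q ^ n dvd nat b \<longleftrightarrow> int q ^ n dvd b" for n
      using b int_dvd_int_iff[of "q ^ n" "nat b"] by simp
    then show ?thesis using b by (simp add: multiplicity_def)
  qed
  show sub: "prime_factors (nat b) \<subseteq> P"
  proof
    fix q assume qb: "q \<in> prime_factors (nat b)"
    then have q: "prime q" "q dvd nat b" by auto
    \<comment> \<open>A prime outside \<open>P\<close> that divides the denominator would make the
      absolute value there greater than 1.\<close>
    show "q \<in> P"
    proof (rule ccontr)
      assume "q \<notin> P"
      then have "real q ^ multiplicity (int q) b \<le> 1"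
        using prime_power_denominator_le[OF q(1) x] int[OF q(1)] by simp
      moreover have "multiplicity (int q) b > 0"
        using qb by (simp add: mult[symmetric] prime_factors_multiplicity)
      then have "1 < real q ^ multiplicity (int q) b"
        using prime_gt_1_nat[OF q(1)] by (intro one_less_power) auto
      ultimately show False by simp
    qed
  qed
  \<comment> \<open>All prime factors lie in \<open>P\<close>, so the factorization may range over
    \<open>P\<close>, with exponent 0 at the remaining primes.\<close>
  have "nat b = (\<Prod>p\<in>prime_factors (nat b). p ^ multiplicity p (nat b))"
    using b by (intro prime_factorization_nat) simp
  also have "\<dots> = (\<Prod>p\<in>P. p ^ multiplicity p (nat b))"
    using sub P by (intro prod.mono_neutral_left) (auto simp: prime_factors_multiplicity)
  finally have eq: "nat b = (\<Prod>p\<in>P. p ^ multiplicity p (nat b))" .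
  have "real (nat b) = (\<Prod>p\<in>P. real p ^ multiplicity p (nat b))"
    using arg_cong[OF eq, of real] unfolding of_nat_prod of_nat_power .
  also have "\<dots> \<le> (\<Prod>p\<in>P. max 1 (rat_absp p x))"
    using P mult prime_power_denominator_le[OF _ x] by (intro prod_mono) auto
  finally show "real_of_int b \<le> (\<Prod>p\<in>P. max 1 (rat_absp p x))" using b by simp
qed

text \<open>The finite places bound the denominator. The numerator is the entry times the
  denominator, so the infinite place supplies exactly the missing summand.\<close>

lemma ln_quotient_le_half_adelic_length:
  fixes f :: "rat^'n::{finite,linorder}^'n::{finite,linorder}"
  assumes P: "\<forall>p\<in>P. prime p" "finite P" and x: "quotient_of (f $ i $ j) = (a, b)"
    and int: "\<And>q. prime q \<Longrightarrow> q \<notin> P \<Longrightarrow> rat_absp q (f $ i $ j) \<le> 1"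
  shows "ln (real_of_int b) \<le> half_adelic_length P f"
    "a \<noteq> 0 \<Longrightarrow> ln \<bar>real_of_int a\<bar> \<le> half_adelic_length P f"
proof -
  let ?x = "f $ i $ j"
  have b: "b > 0" using quotient_of_denom_pos[OF x] .
  have "ln (real_of_int b) \<le> ln (\<Prod>p\<in>P. max 1 (rat_absp p ?x))"
    using P_integral_denominator(2)[OF P x int] b by (subst ln_le_cancel_iff) (auto intro!: prod_pos)
  also have "\<dots> = (\<Sum>p\<in>P. ln (max 1 (rat_absp p ?x)))"
    using P(2) by (intro ln_prod) auto
  also have "\<dots> \<le> (\<Sum>p\<in>P. ln_plus (op_norm (Finite p) f))"
  proof (rule sum_mono)
    fix p assume "p \<in> P"
    then have "rat_absp p ?x \<le> op_norm (Finite p) f"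
      using P by (intro rat_absp_entry_le_op_norm) blast
    then show "ln (max 1 (rat_absp p ?x)) \<le> ln_plus (op_norm (Finite p) f)"
      by (cases "rat_absp p ?x \<le> 1") (auto simp: max_def intro: ln_le_ln_plus)
  qed
  finally have den: "ln (real_of_int b) \<le> (\<Sum>p\<in>P. ln_plus (op_norm (Finite p) f))" .
  then show "ln (real_of_int b) \<le> half_adelic_length P f"
    using ln_plus_nonneg[of "op_norm Infinite f"] unfolding half_adelic_length_def by linarith
  assume a: "a \<noteq> 0"
  have xab: "?x = of_int a / of_int b" by (rule quotient_of_div[OF x])
  have "\<bar>real_of_rat ?x\<bar> = \<bar>real_of_int a\<bar> / real_of_int b"
    using b unfolding xab by (simp add: of_rat_divide)
  then have "ln \<bar>real_of_rat ?x\<bar> = ln \<bar>real_of_int a\<bar> - ln (real_of_int b)"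
    using a b by (simp add: ln_div)
  moreover have "ln \<bar>real_of_rat ?x\<bar> \<le> ln_plus (op_norm Infinite f)"
    using a b xab by (intro ln_le_ln_plus abs_entry_le_op_norm) auto
  ultimately show "ln \<bar>real_of_int a\<bar> \<le> half_adelic_length P f"
    using den unfolding half_adelic_length_def by linarith
qed

text \<open>Write \<open>f = D N\<close> with \<open>D\<close> the diagonal part of \<open>f\<close> and \<open>N\<close> unipotent.\<close>

lemma has_word_half_adelic_length:
  fixes f :: "rat^'n::{finite,linorder}^'n::{finite,linorder}"
  assumes P: "\<forall>p\<in>P. prime p" "finite P" and p: "p \<in> P" and f: "triangular_P_integral P f"
  defines "h \<equiv> half_adelic_length P f"
  shows "has_word P f (real CARD('n) * (4 * h)
    + (real CARD('n))\<^sup>2 * ((1 + 4 * h) * (real p + 2) + 8 * h))"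
proof -
  have low: "f $ i $ j = 0" if "j < i" for i j
    using f that by (simp add: triangular_P_integral_def)
  have pos: "f $ i $ i > 0" for i
    using f by (simp add: triangular_P_integral_def)
  have unit: "rat_absp q (f $ i $ i) = 1" if "prime q" "q \<notin> P" for i q
    using f that by (simp add: triangular_P_integral_def)
  have int: "rat_absp q (f $ i $ j) \<le> 1" if "prime q" "q \<notin> P" for q i j
    using f that by (simp add: triangular_P_integral_def)
  have h: "0 \<le> h" unfolding h_def by (rule half_adelic_length_nonneg)
  define a b where "a = (\<lambda>i j. fst (quotient_of (f $ i $ j)))" and "b = (\<lambda>i j. snd (quotient_of (f $ i $ j)))"
  have q: "quotient_of (f $ i $ j) = (a i j, b i j)" for i j by (simp add: a_def b_def)
  have b: "b i j > 0" for i j using quotient_of_denom_pos[OF q] .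
  have fab: "f $ i $ j = of_int (a i j) / of_int (b i j)" for i j by (rule quotient_of_div[OF q])
  have a: "a i i > 0" for i using pos[of i] b[of i i] unfolding fab by (simp add: zero_less_divide_iff)
  have lnb: "ln (real_of_int (b i j)) \<le> h"
    and lna: "a i j \<noteq> 0 \<Longrightarrow> ln \<bar>real_of_int (a i j)\<bar> \<le> h" for i j
    unfolding h_def using ln_quotient_le_half_adelic_length[OF P q int] by blast+
  have pb: "prime_factors (nat (b i j)) \<subseteq> P" for i j
    by (rule P_integral_denominator(1)[OF P q int])
  \<comment> \<open>The reciprocal of a diagonal entry is also integral outside \<open>P\<close>,
    and its reduced denominator is \<open>a i i\<close>. The denominator criterion therefore applies
    to the numerator.\<close>
  have pa: "prime_factors (nat (a i i)) \<subseteq> P" for i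
  proof (rule P_integral_denominator(1)[OF P])
    show "quotient_of (inverse (f $ i $ i)) = (b i i, a i i)"
      using q[of i i] a[of i] by (simp add: rat_inverse_code)
    fix l assume "prime l" "l \<notin> P"
    then show "rat_absp l (inverse (f $ i $ i)) \<le> 1" by (simp add: rat_absp_inverse unit)
  qed
  define N where "N = (\<chi> i j. f $ i $ j / f $ i $ i)"
  let ?c = "(1 + 4 * h) * (real p + 2) + 8 * h"
  have c: "0 \<le> ?c" using h by simp
  have wN: "has_word P N (real (card {(i, j). i < j \<and> N $ i $ j \<noteq> 0}) * ?c)"
  proof (rule has_word_unipotent[OF c])
    fix i show "N $ i $ i = 1" using pos[of i] by (simp add: N_def)
  next
    fix i j :: 'n assume "j < i" then show "N $ i $ j = 0" by (simp add: N_def low)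
  next
    fix r s :: 'n assume rs: "r < s"
    \<comment> \<open>Dividing row \<open>r\<close> by its diagonal entry gives this possibly
      unreduced fraction. Each side is a product of two numbers of logarithm at most
      \<open>h\<close>, hence the bound \<open>2 * h\<close>.\<close>
    let ?A = "a r s * b r r" and ?B = "nat (b r s) * nat (a r r)"
    have N: "N $ r $ s = of_int ?A / of_nat ?B"
      using a[of r] b[of r r] b[of r s] by (simp add: N_def fab)
    have "has_word P (theta r s (of_int ?A / of_nat ?B)) ((1 + 2 * (2 * h)) * (real p + 2) + 4 * (2 * h))"
    proof (rule has_word_theta_offdiag[OF P(1) p rs])
      show "?B > 0" using a b by simp
      show "prime_factors ?B \<subseteq> P"
        using a[of r] b[of r s] pa[of r] pb[of r s] by (subst prime_factors_product) auto
      show "0 \<le> 2 * h" using h by simp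
      have "ln (real ?B) = ln (real_of_int (b r s)) + ln \<bar>real_of_int (a r r)\<bar>"
        using a[of r] b[of r s] by (simp add: ln_mult)
      then show "ln (real ?B) \<le> 2 * h" using lnb[of r s] lna[of r r] a[of r] by simp
      assume "?A \<noteq> 0"
      then have "a r s \<noteq> 0" by simp
      then have "ln \<bar>real_of_int ?A\<bar> = ln \<bar>real_of_int (a r s)\<bar> + ln (real_of_int (b r r))"
        using b[of r r] by (simp add: abs_mult ln_mult)
      then show "ln \<bar>real_of_int ?A\<bar> \<le> 2 * h" using lnb[of r r] lna[OF \<open>a r s \<noteq> 0\<close>] by simp
    qed
    then show "has_word P (theta r s (N $ r $ s)) ?c" unfolding N by simp
  qed
  have "card {(i, j). i < j \<and> N $ i $ j \<noteq> 0} \<le> card (UNIV :: ('n \<times> 'n) set)"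
    by (intro card_mono) auto
  also have "\<dots> = CARD('n)\<^sup>2" by (simp add: power2_eq_square)
  finally have "real (card {(i, j). i < j \<and> N $ i $ j \<noteq> 0}) \<le> real (CARD('n)\<^sup>2)"
    by (rule of_nat_mono)
  then have card: "real (card {(i, j). i < j \<and> N $ i $ j \<noteq> 0}) \<le> (real CARD('n))\<^sup>2"
    unfolding of_nat_power .
  have wN': "has_word P N ((real CARD('n))\<^sup>2 * ?c)"
    by (rule has_word_mono[OF wN mult_right_mono[OF card c]])
  \<comment> \<open>Numerator and denominator of a diagonal entry each cost at most
    \<open>2 * h\<close> diagonal letters.\<close>
  have wD: "has_word P (theta i i (f $ i $ i)) (4 * h)" for i
  proof -
    have "theta i i (f $ i $ i) = theta i i (of_nat (nat (a i i))) ** theta i i (1 / of_nat (nat (b i i)))"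
      using a[of i] b[of i i] by (simp add: theta_diag_mult fab)
    moreover have "has_word P (theta i i (of_nat (nat (a i i)))) (2 * ln (real (nat (a i i))))"
      using has_word_theta_diag[OF P(1) _ pa[of i], of i] a[of i] by simp
    moreover have "has_word P (theta i i (1 / of_nat (nat (b i i)))) (2 * ln (real (nat (b i i))))"
      using has_word_theta_diag[OF P(1) _ pb[of i i], of i] b[of i i] by simp
    ultimately have "has_word P (theta i i (f $ i $ i))
        (2 * ln (real (nat (a i i))) + 2 * ln (real (nat (b i i))))"
      using has_word_mult by metis
    then show ?thesis
      by (rule has_word_mono) (use a[of i] b[of i i] lna[of i i] lnb[of i i] in simp)
  qed
  have "(\<chi> i j. f $ i $ i * N $ i $ j) = f"
  proof -
    have "f $ i $ i \<noteq> 0" for i using pos[of i] by simp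
    then show ?thesis by (simp add: vec_eq_iff N_def)
  qed
  then show ?thesis using has_word_scale_rows[OF wD wN'] by simp
qed

theorem proposition4p3p1:
  fixes P :: "nat set"
  assumes "finite P" and "P \<noteq> {}" and "\<forall>p\<in>P. prime p"
  shows "\<exists>Q R S T :: real. Q > 0 \<and> R > 0 \<and> S > 0 \<and> T > 0 \<and>
           (\<forall>f \<in> (FG P :: (rat^'n::{finite,linorder}^'n::{finite,linorder}) set).
              (f \<noteq> mat 1 \<longrightarrow> Q + R * adelic_length f \<le> real (word_length P f)) \<and>
              real (word_length P f) \<le> S + T * adelic_length f)"
proof -
  note P = assms(3,1)
  \<comment> \<open>Any one prime of the nonempty set \<open>P\<close> serves as the base of
    Horner's scheme.\<close>
  obtain p where p: "p \<in> P" using assms(2) by blast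
  define m where "m = Max P"
  have m: "\<forall>p\<in>P. p \<le> m" using assms(1) by (simp add: m_def)
  have "1 \<le> p" using P(1) p prime_ge_1_nat by blast
  then have m1: "1 \<le> m" using m p order_trans by blast
  let ?n = "real CARD('n)"
  \<comment> \<open>\<open>D\<close> bounds the growth of \<open>half_adelic_length\<close> per
    letter; \<open>C\<close> accounts for both \<open>f\<close> and its inverse.\<close>
  define D where "D = (2 * ln ?n + ln (real (CARD('n) * m)) + (\<Sum>p\<in>P. ln (real p)))"
  define C where "C = 2 * D"
  \<comment> \<open>\<open>T\<close> and \<open>S\<close> are the coefficient of \<open>h\<close>
    and the constant term in the bound of \<open>has_word_half_adelic_length\<close>.\<close>
  define T where "T = 4 * ?n + ?n\<^sup>2 * (4 * (real p + 2) + 8)"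
  define S where "S = ?n\<^sup>2 * (real p + 2)"
  have n1: "1 \<le> ?n" by (simp add: Suc_leI)
  have C0: "C \<ge> 0"
  proof -
    have "1 \<le> CARD('n) * m" using m1 by (simp add: Suc_leI)
    then have "0 \<le> ln (real (CARD('n) * m))" by (intro ln_ge_zero) linarith
    moreover have "0 \<le> (\<Sum>p\<in>P. ln (real p))"
      using P(1) prime_ge_1_nat by (intro sum_nonneg ln_ge_zero) fastforce
    ultimately show ?thesis unfolding C_def D_def using n1 by simp
  qed
  have "T > 0" unfolding T_def using n1 by (intro add_pos_nonneg) auto
  moreover have "S > 0" unfolding S_def using n1 by simp
  \<comment> \<open>The word length is at least 1 for \<open>f \<noteq> mat 1\<close>: one half of
    it pays for the constant, the other half for the adelic length.\<close>
  moreover have "1 / 2 + 1 / (2 * (C + 1)) * adelic_length f \<le> real (word_length P f)"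
    if f: "f \<in> FG P" and ne: "f \<noteq> mat 1" for f :: "rat^'n::{finite,linorder}^'n::{finite,linorder}"
  proof -
    let ?k = "word_length P f"
    obtain k0 where k0: "has_word P f k0" using FG_has_word[OF f P(1)] by blast
    then have w: "has_word P f (real ?k)" by (rule has_word_word_length)
    have w': "has_word P (matrix_inv f) (real ?k)" using has_word_inverse[OF w P(1)] by blast
    have k: "1 \<le> ?k"
    proof (rule ccontr)
      assume "\<not> 1 \<le> ?k"
      then have "?k = 0" by simp
      then have "has_word P f 0" using w by (simp only: of_nat_0)
      then show False using ne by (auto simp: has_word_def)
    qed
    have "adelic_length f \<le> real ?k * C"
      using half_adelic_length_le[OF w P m m1 k] half_adelic_length_le[OF w' P m m1 k]
      unfolding adelic_length_eq[OF w P] D_def[symmetric] C_def by simp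
    \<comment> \<open>Using \<open>C + 1\<close> keeps the divisor positive even if
      \<open>C = 0\<close>.\<close>
    also have "\<dots> \<le> real ?k * (C + 1)" by (simp add: mult_left_mono)
    finally have "1 / (2 * (C + 1)) * adelic_length f \<le> real ?k / 2"
      using C0 by (simp add: field_simps)
    moreover have "1 / 2 \<le> real ?k / 2" using k by simp
    ultimately show ?thesis by linarith
  qed
  moreover have "real (word_length P f) \<le> S + T * adelic_length f" if f: "f \<in> FG P"
    for f :: "rat^'n::{finite,linorder}^'n::{finite,linorder}"
  proof -
    obtain k0 where w: "has_word P f k0" using FG_has_word[OF f P(1)] by blast
    have "real (word_length P f) \<le> S + T * half_adelic_length P f"
      using word_length_le[OF has_word_half_adelic_length[OF P p has_word_triangular_P_integral[OF w P(1)]]]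
      unfolding S_def T_def by (simp add: algebra_simps)
    \<comment> \<open>The contribution of the inverse is nonnegative and may simply be
      added.\<close>
    also have "\<dots> \<le> S + T * adelic_length f"
      unfolding adelic_length_eq[OF w P]
      using \<open>T > 0\<close> half_adelic_length_nonneg by (intro add_left_mono mult_left_mono) auto
    finally show ?thesis .
  qed
  ultimately show ?thesis
    using C0 by (intro exI[of _ "1 / 2"] exI[of _ "1 / (2 * (C + 1))"] exI[of _ S] exI[of _ T]) auto
qed

end
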